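(* Let $R$ be a commutative domain of characteristic zero containing $\mathbb{Q}$, $d$ a nonzero derivation of $R$, and $\Gamma$ a group acting (on the right) by automorphisms on $R$. Then the action of $\Gamma$ on $R$ extends to an action of $\Gamma$ by automorphisms on $C=R(\!(y;\tfrac12 d)\!)_2$ if and only if it is quadratically $d$-compatible. In this case the subring $B=R(\!(x;d)\!)$ of $C$ (with $x=y^2$) is stable under the extended action.
   Context: $U(R)$ is the group of invertible elements of $R$. For a derivation $\delta$ of $R$, $R(\!(y;\delta)\!)_2$ is the ring of quadratic formal pseudodifferential operators: its elements are the Laurent series $\sum_{i\ge m}f_iy^i$ ($m\in\mathbb{Z}$, $f_i\in R$), with multiplication determined by $yf=\sum_{k\ge0}\frac{(2k)!}{2^k(k!)^2}\delta^k(f)y^{2k+1}$ for $f\in R$. With $\delta=\frac12d$, the element $x=y^2$ satisfies $xf=\sum_{n\ge0}d^n(f)x^{n+1}$, so $C$ contains as a subring the ring $B=R(\!(x;d)\!)$ of Laurent series in $x$ with coefficients in $R$ and this commutation law. Actions are right actions: $(f\cdot\gamma)\cdot\gamma'=f\cdot\gamma\gamma'$. $Z^1(\Gamma,U(R))$ is the group of maps $s:\Gamma\to U(R)$, $\gamma\mapsto s_\gamma$, with $s_{\gamma\gamma'}=(s_\gamma\cdot\gamma')s_{\gamma'}$ for all $\gamma,\gamma'$. The action of $\Gamma$ on $R$ is quadratically $d$-compatible if there exists $s\in Z^1(\Gamma,U(R))$ such that $d(f)\cdot\gamma=s_\gamma^2\,d(f\cdot\gamma)$ for all $\gamma\in\Gamma$,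 $f\in R$. An action on $C$ extends the action on $R$ if its restriction to $R$ is the given action. *)

theory Defs
  imports
    "HOL-Algebra.QuotRing"
    "HOL-Computational_Algebra.Formal_Laurent_Series"
begin

notation fls_nth (infixl "$$" 75)

definition type_ring :: "'a::ring_1 ring"
  where "type_ring =
    \<lparr>carrier = UNIV, monoid.mult = (*), one = 1, zero = 0, add = (+)\<rparr>"

definition rational_embedding :: "(rat \<Rightarrow> 'a::ring_1) \<Rightarrow> bool"
  where "rational_embedding \<iota> \<longleftrightarrow> \<iota> \<in> ring_hom type_ring type_ring \<and> inj \<iota>"

definition derivation :: "('a::ring_1 \<Rightarrow> 'a) \<Rightarrow> bool"
  where "derivation d \<longleftrightarrow>
    (\<forall>f g. d (f + g) = d f + d g) \<and> (\<forall>f g. d (f * g) = d f * g + f * d g)"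


subsection \<open>Quadratic formal pseudodifferential operators\<close>

text \<open>
  The underlying additive group is that of the Laurent series type \<open>'a fls\<close>: \<open>F\<close> stands for
  the sum of the \<open>F $$ i * y^i\<close> with coefficients written on the left.  The commutative
  product of \<open>'a fls\<close> plays no role.

  In the following definition, \<open>\<iota>\<close> embeds the rationals.  The operator is left
  multiplication by \<open>y\<close> as dictated by the commutation law, extended to Laurent series:
  \<open>y (\<Sum>j. g\<^sub>j y^j) = (\<Sum>j. (y g\<^sub>j) y^j)\<close>.  The range of summation only omits
  terms in which \<open>G $$ (n - 2 * int k - 1)\<close> vanishes.
\<close>

definition y_times :: "(rat \<Rightarrow> 'a) \<Rightarrow> ('a \<Rightarrow> 'a) \<Rightarrow> 'a::comm_ring_1 fls \<Rightarrow> 'a fls"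
  where "y_times \<iota> \<delta> G = Abs_fls (\<lambda>n.
    \<Sum>k | fls_subdegree G + 2 * int k + 1 \<le> n.
      \<iota> (fact (2 * k) / (2 ^ k * (fact k)\<^sup>2)) * (\<delta> ^^ k) (G $$ (n - 2 * int k - 1)))"

text \<open>
  Left multiplication by \<open>y^i\<close>.  For a derivation \<open>\<delta>\<close>, \<open>y_times\<close> is a
  bijection (see \<open>bij_y_times\<close> below), so its inverse is left multiplication by \<open>y\<inverse>\<close>.
\<close>

definition y_power_times ::
    "(rat \<Rightarrow> 'a) \<Rightarrow> ('a \<Rightarrow> 'a) \<Rightarrow> int \<Rightarrow> 'a::comm_ring_1 fls \<Rightarrow> 'a fls"
  where "y_power_times \<iota> \<delta> i =
    (if i \<ge> 0 then y_times \<iota> \<delta> ^^ nat i else inv_into UNIV (y_times \<iota> \<delta>) ^^ nat (- i))"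

text \<open>
  \<open>(\<Sum>i. f\<^sub>i y^i) G = (\<Sum>i. f\<^sub>i (y^i G))\<close>; since \<open>y^i G\<close> starts in degree
  \<open>i + fls_subdegree G\<close>, only finitely many \<open>i\<close> contribute to each coefficient.
\<close>

definition pdo_mult ::
    "(rat \<Rightarrow> 'a) \<Rightarrow> ('a \<Rightarrow> 'a) \<Rightarrow> 'a::comm_ring_1 fls \<Rightarrow> 'a fls \<Rightarrow> 'a fls"
  where "pdo_mult \<iota> \<delta> F G = Abs_fls (\<lambda>n.
    \<Sum>i \<in> {fls_subdegree F .. n - fls_subdegree G}.
      F $$ i * y_power_times \<iota> \<delta> i G $$ n)"

definition pdo_ring :: "(rat \<Rightarrow> 'a) \<Rightarrow> ('a \<Rightarrow> 'a) \<Rightarrow> 'a::comm_ring_1 fls ring"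
  where "pdo_ring \<iota> \<delta> =
    \<lparr>carrier = UNIV, monoid.mult = pdo_mult \<iota> \<delta>, one = 1, zero = 0, add = (+)\<rparr>"

text \<open>
  The Laurent series in \<open>x = y^2\<close>: \<open>fls_compose_power g 2\<close> is the series
  \<open>(\<Sum>i. g\<^sub>i y^(2 i))\<close>.
\<close>

definition pdo_even :: "'a::comm_ring_1 fls set"
  where "pdo_even = range (\<lambda>g. fls_compose_power g 2)"


subsection \<open>Group actions\<close>

text \<open>In all that follows, \<open>act \<gamma> f\<close> is \<open>f \<cdot> \<gamma>\<close>.\<close>

definition right_action_by_automorphisms ::
    "('g, 'm) monoid_scheme \<Rightarrow> ('r, 'n) ring_scheme \<Rightarrow> ('g \<Rightarrow> 'r \<Rightarrow> 'r) \<Rightarrow> bool"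
  where "right_action_by_automorphisms \<Gamma> R act \<longleftrightarrow>
    (\<forall>\<gamma> \<in> carrier \<Gamma>. act \<gamma> \<in> ring_iso R R) \<and>
    (\<forall>f \<in> carrier R. act \<one>\<^bsub>\<Gamma>\<^esub> f = f) \<and>
    (\<forall>\<gamma> \<in> carrier \<Gamma>. \<forall>\<gamma>' \<in> carrier \<Gamma>. \<forall>f \<in> carrier R.
      act \<gamma>' (act \<gamma> f) = act (\<gamma> \<otimes>\<^bsub>\<Gamma>\<^esub> \<gamma>') f)"

definition unit_cocycles ::
    "('g, 'm) monoid_scheme \<Rightarrow> ('g \<Rightarrow> 'a \<Rightarrow> 'a) \<Rightarrow> ('g \<Rightarrow> 'a::comm_ring_1) set"
  where "unit_cocycles \<Gamma> act =
    {s \<in> carrier \<Gamma> \<rightarrow> Units type_ring.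
      \<forall>\<gamma> \<in> carrier \<Gamma>. \<forall>\<gamma>' \<in> carrier \<Gamma>. s (\<gamma> \<otimes>\<^bsub>\<Gamma>\<^esub> \<gamma>') = act \<gamma>' (s \<gamma>) * s \<gamma>'}"

definition quadratically_compatible ::
    "('g, 'm) monoid_scheme \<Rightarrow> ('a::comm_ring_1 \<Rightarrow> 'a) \<Rightarrow> ('g \<Rightarrow> 'a \<Rightarrow> 'a) \<Rightarrow> bool"
  where "quadratically_compatible \<Gamma> d act \<longleftrightarrow>
    (\<exists>s \<in> unit_cocycles \<Gamma> act. \<forall>\<gamma> \<in> carrier \<Gamma>. \<forall>f.
      act \<gamma> (d f) = (s \<gamma>)\<^sup>2 * d (act \<gamma> f))"

definition extends_to_pdo ::
    "(rat \<Rightarrow> 'a) \<Rightarrow> ('a \<Rightarrow> 'a) \<Rightarrow> ('g, 'm) monoid_scheme \<Rightarrow> ('g \<Rightarrow> 'a \<Rightarrow> 'a) \<Rightarrow>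
      ('g \<Rightarrow> 'a::comm_ring_1 fls \<Rightarrow> 'a fls) \<Rightarrow> bool"
  where "extends_to_pdo \<iota> \<delta> \<Gamma> act Act \<longleftrightarrow>
    right_action_by_automorphisms \<Gamma> (pdo_ring \<iota> \<delta>) Act \<and>
    (\<forall>\<gamma> \<in> carrier \<Gamma>. \<forall>f. Act \<gamma> (fls_const f) = fls_const (act \<gamma> f))"


subsection \<open>Left multiplication by \<open>y\<close>\<close>

lemma rational_embeddingD:
  assumes "rational_embedding \<iota>"
  shows "\<iota> (p + q) = \<iota> p + \<iota> q" "\<iota> (p * q) = \<iota> p * \<iota> q" "\<iota> 1 = 1" "\<iota> 0 = 0"
proof -
  show add: "\<iota> (p + q) = \<iota> p + \<iota> q" for p q
    using assms by (simp add: rational_embedding_def ring_hom_def type_ring_def)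
  show "\<iota> (p * q) = \<iota> p * \<iota> q" "\<iota> 1 = 1"
    using assms by (simp_all add: rational_embedding_def ring_hom_def type_ring_def)
  show "\<iota> 0 = 0" using add[of 0 0] by simp
qed

lemma rational_embedding_sum:
  assumes "rational_embedding \<iota>"
  shows "\<iota> (sum f A) = (\<Sum>x\<in>A. \<iota> (f x))"
  by (induction A rule: infinite_finite_induct) (simp_all add: rational_embeddingD[OF assms])

lemma derivation_0:
  assumes "derivation d"
  shows "d 0 = 0"
  using assms unfolding derivation_def by (metis add_cancel_right_right add_0)

lemma derivation_rational_scale:
  fixes \<iota> :: "rat \<Rightarrow> 'a::comm_ring_1"
  assumes d: "derivation d" and \<iota>: "rational_embedding \<iota>"
  shows "d (\<iota> q * f) = \<iota> q * d f"
proof -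
  note E = rational_embeddingD[OF \<iota>]
  have add: "d (f + g) = d f + d g" and mult: "d (f * g) = d f * g + f * d g" for f g
    using d by (simp_all add: derivation_def)
  have one: "d 1 = 0" using mult[of 1 1] by simp
  have nat0: "d (\<iota> (of_nat n)) = 0" for n
    by (induction n) (simp_all add: E add one derivation_0[OF d])
  have neg: "\<iota> (- p) = - \<iota> p" for p using E(1)[of p "- p"] E(4)
    by (simp add: eq_neg_iff_add_eq_0 add.commute)
  have dneg: "d (- g) = - d g" for g using add[of g "- g"] derivation_0[OF d]
    by (simp add: eq_neg_iff_add_eq_0 add.commute)
  have int0: "d (\<iota> (of_int m)) = 0" for m
    by (cases m rule: int_cases2) (simp_all add: nat0 neg dneg)
  obtain a b where q: "q = of_int a / of_int b" "b > 0"
    by (metis quotient_of_div quotient_of_denom_pos surj_pair)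
  have "\<iota> (of_int b) * \<iota> q = \<iota> (of_int a)"
    using q by (simp flip: E(2))
  then have "\<iota> (of_int b) * d (\<iota> q) = 0"
    using mult[of "\<iota> (of_int b)" "\<iota> q"] int0 by simp
  then have "\<iota> (1 / of_int b) * (\<iota> (of_int b) * d (\<iota> q)) = 0" by simp
  then have "d (\<iota> q) = 0"
    using q E(3) by (simp add: mult.assoc[symmetric] E(2)[symmetric])
  then show ?thesis by (simp add: mult)
qed

lemma y_times_nth:
  "y_times \<iota> \<delta> G $$ n = (\<Sum>k | fls_subdegree G + 2 * int k + 1 \<le> n.
     \<iota> (fact (2 * k) / (2 ^ k * (fact k)\<^sup>2)) * (\<delta> ^^ k) (G $$ (n - 2 * int k - 1)))"
  unfolding y_times_def
proof (rule nth_Abs_fls_lower_bound[of "fls_subdegree G"], intro allI impI)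
  fix n assume "n < fls_subdegree G"
  then have "{k. fls_subdegree G + 2 * int k + 1 \<le> n} = {}" by auto
  then show "(\<Sum>k | fls_subdegree G + 2 * int k + 1 \<le> n.
     \<iota> (fact (2 * k) / (2 ^ k * (fact k)\<^sup>2)) * (\<delta> ^^ k) (G $$ (n - 2 * int k - 1))) = 0"
    by simp
qed

lemma pdo_mult_nth:
  "pdo_mult \<iota> \<delta> F G $$ n = (\<Sum>i \<in> {fls_subdegree F .. n - fls_subdegree G}.
     F $$ i * y_power_times \<iota> \<delta> i G $$ n)"
  unfolding pdo_mult_def
  by (rule nth_Abs_fls_lower_bound[of "fls_subdegree F + fls_subdegree G"]) simp

text \<open>The defining commutation law.\<close>

lemma pdo_mult_y_const:
  fixes f :: "'a::comm_ring_1"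
  assumes "derivation \<delta>"
  shows "pdo_mult \<iota> \<delta> fls_X (fls_const f) $$ n =
    (if odd n \<and> n > 0
     then \<iota> (fact (2 * nat (n div 2)) / (2 ^ nat (n div 2) * (fact (nat (n div 2)))\<^sup>2)) *
       (\<delta> ^^ nat (n div 2)) f
     else 0)"
proof -
  have pow0: "(\<delta> ^^ k) 0 = 0" for k
    by (induction k) (simp_all add: derivation_0[OF assms])
  have "pdo_mult \<iota> \<delta> fls_X (fls_const f) $$ n = y_times \<iota> \<delta> (fls_const f) $$ n"
  proof (cases "n \<ge> 1")
    case True
    then have "pdo_mult \<iota> \<delta> fls_X (fls_const f) $$ n =
      (\<Sum>i\<in>{1}. fls_X $$ i * y_power_times \<iota> \<delta> i (fls_const f) $$ n)"
      unfolding pdo_mult_nth by (intro sum.mono_neutral_right) auto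
    then show ?thesis by (simp add: y_power_times_def)
  next
    case False
    then have "{k::nat. 2 * int k + 1 \<le> n} = {}" by auto
    with False show ?thesis by (simp add: pdo_mult_nth y_times_nth)
  qed
  also have "\<dots> = (\<Sum>k | 2 * int k + 1 \<le> n. if n = 2 * int k + 1 then
      \<iota> (fact (2 * k) / (2 ^ k * (fact k)\<^sup>2)) * (\<delta> ^^ k) f else 0)"
    unfolding y_times_nth by (rule sum.cong) (auto simp: pow0)
  also have "\<dots> = (if odd n \<and> n > 0
     then \<iota> (fact (2 * nat (n div 2)) / (2 ^ nat (n div 2) * (fact (nat (n div 2)))\<^sup>2)) *
       (\<delta> ^^ nat (n div 2)) f
     else 0)"
  proof (cases "odd n \<and> n > 0")
    case True
    have fin: "finite {k::nat. 2 * int k + 1 \<le> n}"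
      by (rule finite_subset[of _ "{..nat n}"]) auto
    have eq: "n = 2 * int k + 1 \<longleftrightarrow> k = nat (n div 2)" for k
      using True by (auto elim!: oddE)
    have mem: "2 * int (nat (n div 2)) + 1 \<le> n"
      using eq[of "nat (n div 2)"] by simp
    show ?thesis using fin mem
      by (simp only: eq sum.delta' sum.delta True mem_Collect_eq if_True simp_thms)
  next
    case False
    then show ?thesis by (auto intro!: sum.neutral)
  qed
  finally show ?thesis .
qed

definition even_shift_sum ::
    "(rat \<Rightarrow> 'a) \<Rightarrow> ('a \<Rightarrow> 'a) \<Rightarrow> rat fps \<Rightarrow> 'a::comm_ring_1 fls \<Rightarrow> 'a fls"
  where "even_shift_sum \<iota> \<delta> a G = Abs_fls (\<lambda>n.
    \<Sum>k | fls_subdegree G + 2 * int k \<le> n.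
      \<iota> (fps_nth a k) * (\<delta> ^^ k) (G $$ (n - 2 * int k)))"

context
  fixes \<iota> :: "rat \<Rightarrow> 'a::comm_ring_1" and \<delta> :: "'a \<Rightarrow> 'a"
  assumes d: "derivation \<delta>" and \<iota>: "rational_embedding \<iota>"
begin

lemma pow_add: "(\<delta> ^^ k) (f + g) = (\<delta> ^^ k) f + (\<delta> ^^ k) g"
  using d by (induction k) (simp_all add: derivation_def)

lemma pow_0: "(\<delta> ^^ k) 0 = 0"
  by (induction k) (simp_all add: derivation_0[OF d])

lemma pow_sum: "(\<delta> ^^ k) (sum f A) = (\<Sum>x\<in>A. (\<delta> ^^ k) (f x))"
  by (induction A rule: infinite_finite_induct) (simp_all add: pow_0 pow_add)

lemma pow_scale: "(\<delta> ^^ k) (\<iota> q * f) = \<iota> q * (\<delta> ^^ k) f"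
  by (induction k) (simp_all add: derivation_rational_scale[OF d \<iota>])

lemma even_shift_sum_nth:
  assumes "n < fls_subdegree G + 2 * int N"
  shows "even_shift_sum \<iota> \<delta> a G $$ n =
    (\<Sum>k<N. \<iota> (fps_nth a k) * (\<delta> ^^ k) (G $$ (n - 2 * int k)))"
proof -
  have "even_shift_sum \<iota> \<delta> a G $$ n = (\<Sum>k | fls_subdegree G + 2 * int k \<le> n.
      \<iota> (fps_nth a k) * (\<delta> ^^ k) (G $$ (n - 2 * int k)))"
    unfolding even_shift_sum_def
  proof (rule nth_Abs_fls_lower_bound[of "fls_subdegree G"], intro allI impI)
    fix n assume "n < fls_subdegree G"
    then have "{k. fls_subdegree G + 2 * int k \<le> n} = {}" by auto
    then show "(\<Sum>k | fls_subdegree G + 2 * int k \<le> n.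
      \<iota> (fps_nth a k) * (\<delta> ^^ k) (G $$ (n - 2 * int k))) = 0" by simp
  qed
  also have "\<dots> = (\<Sum>k<N. \<iota> (fps_nth a k) * (\<delta> ^^ k) (G $$ (n - 2 * int k)))"
    using assms by (intro sum.mono_neutral_left) (auto simp: pow_0)
  finally show ?thesis .
qed

lemma even_shift_sum_below:
  assumes "n < fls_subdegree G"
  shows "even_shift_sum \<iota> \<delta> a G $$ n = 0"
  using even_shift_sum_nth[of n G 0] assms by simp

lemma even_shift_sum_nth':
  assumes "\<And>m. m < M \<Longrightarrow> G $$ m = 0" "n < M + 2 * int N"
  shows "even_shift_sum \<iota> \<delta> a G $$ n =
    (\<Sum>k<N. \<iota> (fps_nth a k) * (\<delta> ^^ k) (G $$ (n - 2 * int k)))"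
proof (cases "G = 0")
  case True
  define N' where "N' = nat n + 1"
  have "n < 2 * int N'" by (simp add: N'_def)
  then show ?thesis using True even_shift_sum_nth[of n G N' a] by (simp add: pow_0)
next
  case False
  then have "M \<le> fls_subdegree G" using assms(1) by (simp add: fls_subdegree_geI)
  then show ?thesis using assms(2) by (intro even_shift_sum_nth) simp
qed

lemma even_shift_sum_mult:
  "even_shift_sum \<iota> \<delta> a (even_shift_sum \<iota> \<delta> b G) = even_shift_sum \<iota> \<delta> (a * b) G"
proof (rule fls_eqI)
  fix n
  define M where "M = fls_subdegree G"
  define N where "N = nat (n - M) + 1"
  define t where "t k l = \<iota> (fps_nth a k * fps_nth b l) *
    (\<delta> ^^ (k + l)) (G $$ (n - 2 * int (k + l)))" for k l
  have N: "n < M + 2 * int N" by (simp add: N_def)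
  have t0: "t k l = 0" if "k + l \<ge> N" for k l
  proof -
    have "int N \<le> int (k + l)" using that by (rule of_nat_mono)
    then have "n - 2 * int (k + l) < M" using N by (smt (verit))
    then show ?thesis by (simp add: t_def M_def pow_0)
  qed
  have "even_shift_sum \<iota> \<delta> a (even_shift_sum \<iota> \<delta> b G) $$ n =
    (\<Sum>k<N. \<iota> (fps_nth a k) * (\<delta> ^^ k) (even_shift_sum \<iota> \<delta> b G $$ (n - 2 * int k)))"
    using N by (intro even_shift_sum_nth') (auto simp: M_def even_shift_sum_below)
  also have "\<dots> = (\<Sum>k<N. \<Sum>l<N. t k l)"
  proof (rule sum.cong)
    fix k assume "k \<in> {..<N}"
    have "even_shift_sum \<iota> \<delta> b G $$ (n - 2 * int k) =
      (\<Sum>l<N. \<iota> (fps_nth b l) * (\<delta> ^^ l) (G $$ (n - 2 * int k - 2 * int l)))"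
      using N by (intro even_shift_sum_nth) (simp add: M_def)
    then show "\<iota> (fps_nth a k) * (\<delta> ^^ k) (even_shift_sum \<iota> \<delta> b G $$ (n - 2 * int k)) =
      (\<Sum>l<N. t k l)"
      by (simp add: pow_sum pow_scale t_def sum_distrib_left funpow_add
          rational_embeddingD(2)[OF \<iota>] mult.assoc diff_diff_eq distrib_left)
  qed simp
  also have "\<dots> = (\<Sum>(k, l)\<in>{..<N} \<times> {..<N}. t k l)"
    by (simp add: sum.cartesian_product)
  also have "\<dots> = (\<Sum>(k, l)\<in>{(i, j). i + j < N}. t k l)"
    using t0 by (intro sum.mono_neutral_right) (auto simp: linorder_not_less[symmetric])
  also have "\<dots> = (\<Sum>m<N. \<Sum>i\<le>m. t i (m - i))"
    by (simp add: sum.triangle_reindex)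
  also have "\<dots> = (\<Sum>m<N. \<iota> (fps_nth (a * b) m) * (\<delta> ^^ m) (G $$ (n - 2 * int m)))"
    by (rule sum.cong) (auto simp: t_def fps_mult_nth rational_embedding_sum[OF \<iota>]
        sum_distrib_right atMost_atLeast0 intro!: sum.cong)
  also have "\<dots> = even_shift_sum \<iota> \<delta> (a * b) G $$ n"
    using N by (intro even_shift_sum_nth[symmetric]) (simp add: M_def)
  finally show "even_shift_sum \<iota> \<delta> a (even_shift_sum \<iota> \<delta> b G) $$ n =
    even_shift_sum \<iota> \<delta> (a * b) G $$ n" .
qed

lemma even_shift_sum_1: "even_shift_sum \<iota> \<delta> 1 G = G"
proof (rule fls_eqI)
  fix n
  define N where "N = nat (n - fls_subdegree G) + 1"
  have "even_shift_sum \<iota> \<delta> 1 G $$ n =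
    (\<Sum>k<N. \<iota> (fps_nth 1 k) * (\<delta> ^^ k) (G $$ (n - 2 * int k)))"
    by (rule even_shift_sum_nth) (simp add: N_def)
  also have "\<dots> = (\<Sum>k\<in>{0}. \<iota> (fps_nth 1 k) * (\<delta> ^^ k) (G $$ (n - 2 * int k)))"
    by (rule sum.mono_neutral_right) (auto simp: N_def rational_embeddingD[OF \<iota>])
  finally show "even_shift_sum \<iota> \<delta> 1 G $$ n = G $$ n"
    by (simp add: rational_embeddingD[OF \<iota>])
qed

lemma y_times_eq:
  "y_times \<iota> \<delta> G = fls_shift (-1)
    (even_shift_sum \<iota> \<delta> (Abs_fps (\<lambda>k. fact (2 * k) / (2 ^ k * (fact k)\<^sup>2))) G)"
proof (rule fls_eqI)
  fix n
  define N where "N = nat (n - fls_subdegree G) + 1"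
  have idx: "n - 2 * int k - 1 = n - 1 - 2 * int k" for k
    by simp
  have zero: "G $$ (n - 1 - 2 * int k) = 0" if "\<not> fls_subdegree G + 2 * int k + 1 \<le> n" for k
    using that by simp
  show "y_times \<iota> \<delta> G $$ n = fls_shift (-1)
    (even_shift_sum \<iota> \<delta> (Abs_fps (\<lambda>k. fact (2 * k) / (2 ^ k * (fact k)\<^sup>2))) G) $$ n"
    unfolding fls_shift_nth y_times_nth
  proof (subst even_shift_sum_nth[where N = N])
    show "n + - 1 < fls_subdegree G + 2 * int N" by (simp add: N_def)
  next
    show "(\<Sum>k | fls_subdegree G + 2 * int k + 1 \<le> n.
        \<iota> (fact (2 * k) / (2 ^ k * (fact k)\<^sup>2)) * (\<delta> ^^ k) (G $$ (n - 2 * int k - 1))) =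
      (\<Sum>k<N. \<iota> (fps_nth (Abs_fps (\<lambda>k. fact (2 * k) / (2 ^ k * (fact k)\<^sup>2))) k) *
        (\<delta> ^^ k) (G $$ (n + - 1 - 2 * int k)))"
    proof (rule sum.mono_neutral_cong_left)
      show "\<forall>k \<in> {..<N} - {k. fls_subdegree G + 2 * int k + 1 \<le> n}.
        \<iota> (fps_nth (Abs_fps (\<lambda>k. fact (2 * k) / (2 ^ k * (fact k)\<^sup>2))) k) *
          (\<delta> ^^ k) (G $$ (n + - 1 - 2 * int k)) = 0"
        using zero by (simp add: pow_0)
    qed (auto simp: N_def idx)
  qed
qed

lemma bij_y_times: "bij (y_times \<iota> \<delta>)"
proof -
  define a :: "rat fps" where "a = Abs_fps (\<lambda>k. fact (2 * k) / (2 ^ k * (fact k)\<^sup>2))"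
  have a: "a * inverse a = 1" "inverse a * a = 1"
    by (simp_all add: a_def inverse_mult_eq_1 inverse_mult_eq_1')
  have "bij (even_shift_sum \<iota> \<delta> a)"
    by (rule o_bij[of "even_shift_sum \<iota> \<delta> (inverse a)"])
      (simp_all add: fun_eq_iff even_shift_sum_mult even_shift_sum_1 a)
  moreover have "bij (fls_shift (-1) :: 'a fls \<Rightarrow> 'a fls)"
    by (rule o_bij[of "fls_shift 1"]) (simp_all add: fun_eq_iff)
  moreover have "y_times \<iota> \<delta> = fls_shift (-1) \<circ> even_shift_sum \<iota> \<delta> a"
    by (simp add: fun_eq_iff y_times_eq a_def)
  ultimately show ?thesis by (simp add: bij_comp)
qed

end

end

theory Submission
  imports Defs
begin

text \<open>
  Write \<open>t = x\<inverse> = y\<^bsup>-2\<^esup>\<close>.  The commutation law of \<open>x\<close> is equivalent to the finite one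
  \<open>t f = f t - d f\<close>, so \<open>C\<close> consists of pseudodifferential operators in \<open>t\<close> with a square
  root \<open>y\<inverse>\<close> of \<open>t\<close> adjoined, and square roots with a given leading term are unique.

  \<^emph>\<open>From compatibility to an action.\<close>  Given \<open>s\<close>, the element \<open>s t s\<close> has leading term
  \<open>s\<^sup>2 t\<close>, and commutation with it induces \<open>- s\<^sup>2 d\<close> on \<open>R\<close>, as the image of \<open>t\<close> under an
  extension of \<open>\<gamma>\<close> must do.  It has a square root with leading term \<open>s y\<inverse>\<close>
  (\<open>square_root_exists\<close>), to which \<open>y\<inverse>\<close> is sent.  That this defines a ring homomorphism
  (\<open>extension_with_exists\<close>) means that \<open>y\<close> and its image obey corresponding commutation laws.
  Their squares do, and \<open>laurent_eval_L\<close> shows that this suffices, by the argument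
  that proves uniqueness of square roots; the same lemma gives associativity of the product.
  If \<open>r\<close> belongs to \<open>\<gamma>'\<close> as \<open>s\<close> does to \<open>\<gamma>\<close>, then the homomorphism for \<open>\<gamma>'\<close> carries \<open>s t s\<close> to
  \<open>(s \<cdot> \<gamma>') r t r (s \<cdot> \<gamma>')\<close>, so the cocycle identity and uniqueness of square roots make
  these homomorphisms into an action.

  \<^emph>\<open>From an action to compatibility.\<close>  Let \<open>\<Theta>\<close> be an automorphism that extends \<open>\<alpha>\<close>.  Comparing
  commutators with elements of \<open>R\<close> shows that \<open>\<Theta> t = a t + b\<close> with \<open>a, b \<in> R\<close>
  (\<open>\<Theta>_x_inverse\<close>).  Hence \<open>\<Theta> y\<inverse>\<close> has a leading term \<open>s y\<inverse>\<close> with \<open>s\<^sup>2 = a\<close>, and \<open>a\<close> is the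
  factor by which \<open>\<alpha>\<close> fails to commute with \<open>d\<close>.  The cocycle identity is read off from
  leading terms, once \<open>\<Theta>\<close> is known to respect the degree filtration (\<open>filtered_\<Theta>\<close>).  No
  continuity is assumed, but a series with constant term \<open>1\<close> has roots of all orders \<open>2\<^sup>k\<close>,
  which pins down the degree of its image.

  \<^emph>\<open>Stability.\<close>  As \<open>a t + b\<close> contains only even powers of \<open>y\<close>, it is fixed by the parity automorphism
  \<open>y \<mapsto> - y\<close>, hence so are the images of all \<open>f x\<^sup>i\<close>, and, by continuity, those of all series in \<open>x\<close>.
\<close>


section \<open>Additive operators on Laurent series\<close>

definition vanishes_below :: "int \<Rightarrow> 'a::zero fls \<Rightarrow> bool"
  where "vanishes_below m F \<longleftrightarrow> (\<forall>n<m. F $$ n = 0)"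

lemma vanishes_belowI: "(\<And>n. n < m \<Longrightarrow> F $$ n = 0) \<Longrightarrow> vanishes_below m F"
  by (simp add: vanishes_below_def)

lemma vanishes_belowD: "vanishes_below m F \<Longrightarrow> n < m \<Longrightarrow> F $$ n = 0"
  by (simp add: vanishes_below_def)

lemma vanishes_below_mono: "vanishes_below m F \<Longrightarrow> k \<le> m \<Longrightarrow> vanishes_below k F"
  by (auto simp: vanishes_below_def)

lemma vanishes_below_0 [simp]: "vanishes_below m 0"
  by (simp add: vanishes_below_def)

lemma vanishes_below_add:
  fixes F G :: "'a::group_add fls"
  shows "vanishes_below m F \<Longrightarrow> vanishes_below m G \<Longrightarrow> vanishes_below m (F + G)"
  by (simp add: vanishes_below_def)

lemma vanishes_below_diff:
  fixes F G :: "'a::group_add fls"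
  shows "vanishes_below m F \<Longrightarrow> vanishes_below m G \<Longrightarrow> vanishes_below m (F - G)"
  by (simp add: vanishes_below_def)

lemma vanishes_below_const_mult:
  fixes F :: "'a::comm_ring_1 fls"
  shows "vanishes_below m F \<Longrightarrow> vanishes_below m (fls_const c * F)"
  by (simp add: vanishes_below_def)

lemma vanishes_below_shift: "vanishes_below m (fls_shift k F) \<longleftrightarrow> vanishes_below (m + k) F"
proof
  assume *: "vanishes_below m (fls_shift k F)"
  show "vanishes_below (m + k) F"
  proof (rule vanishes_belowI)
    fix n assume "n < m + k"
    then have "fls_shift k F $$ (n - k) = 0" by (intro vanishes_belowD[OF *]) simp
    then show "F $$ n = 0" by simp
  qed
qed (simp add: vanishes_below_def)

lemma vanishes_below_subdegree: "vanishes_below (fls_subdegree F) F"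
  by (simp add: vanishes_below_def)

lemma vanishes_below_Suc: "vanishes_below m F \<Longrightarrow> F $$ m = 0 \<Longrightarrow> vanishes_below (m + 1) F"
  unfolding vanishes_below_def zless_add1_eq by blast

lemma vanishes_below_all_eq_0:
  assumes "\<And>k :: nat. vanishes_below (m + int k) F"
  shows "F = 0"
proof (rule fls_zero_eqI)
  fix n
  have "n < m + int (nat (n + 1 - m))" by simp
  then show "F $$ n = 0" using assms vanishes_belowD by blast
qed

lemma vanishes_below_double:
  fixes F :: "'a::{idom, ring_char_0} fls"
  assumes "vanishes_below m (2 * F)"
  shows "vanishes_below m F"
proof (rule vanishes_belowI)
  fix n assume "n < m"
  from vanishes_belowD[OF assms this] have "2 * F $$ n = 0" unfolding mult_2 fls_plus_nth .
  then show "F $$ n = 0" by simp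
qed

definition fls_monom :: "'a::zero \<Rightarrow> int \<Rightarrow> 'a fls"
  where "fls_monom c i = fls_shift (- i) (fls_const c)"

lemma fls_monom_nth [simp]: "fls_monom c i $$ n = (if n = i then c else 0)"
  by (simp add: fls_monom_def)

lemma vanishes_below_monom [simp]: "k \<le> i \<Longrightarrow> vanishes_below k (fls_monom c i)"
  by (simp add: vanishes_below_def)

lemma fls_monom_0 [simp]: "fls_monom 0 i = 0"
  by (rule fls_eqI) simp

lemma fls_monom_eq_0_iff [simp]: "fls_monom c i = 0 \<longleftrightarrow> c = 0"
  by (metis fls_monom_0 fls_monom_nth fls_zero_nth)

lemma fls_monom_degree_0: "fls_monom c 0 = fls_const c"
  by (simp add: fls_monom_def)

lemma fls_shift_monom [simp]: "fls_shift k (fls_monom c i) = fls_monom c (i - k)"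
  by (rule fls_eqI) auto

lemma fls_const_mult_monom [simp]:
  "fls_const (b :: 'a::comm_ring_1) * fls_monom c i = fls_monom (b * c) i"
  by (rule fls_eqI) simp

lemma vanishes_below_diff_lead:
  fixes F :: "'a::group_add fls"
  assumes "vanishes_below m F"
  shows "vanishes_below (m + 1) (F - fls_monom (F $$ m) m)"
  using assms by (intro vanishes_below_Suc) (auto simp: vanishes_below_def)

definition filtered :: "('a::zero fls \<Rightarrow> 'b::zero fls) \<Rightarrow> int \<Rightarrow> bool"
  where "filtered N c \<longleftrightarrow> (\<forall>m F. vanishes_below m F \<longrightarrow> vanishes_below (m + c) (N F))"

lemma filteredD: "filtered N c \<Longrightarrow> vanishes_below m F \<Longrightarrow> vanishes_below (m + c) (N F)"
  by (simp add: filtered_def)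

lemma additive_0:
  fixes N :: "'a::group_add \<Rightarrow> 'b::group_add"
  assumes "\<And>F G. N (F + G) = N F + N G"
  shows "N 0 = 0"
  using assms[of 0 0] by (metis add.right_neutral add_left_cancel)

lemma additive_diff:
  fixes N :: "'a::group_add \<Rightarrow> 'b::group_add"
  assumes "\<And>F G. N (F + G) = N F + N G"
  shows "N (F - G) = N F - N G"
  using assms[of "F - G" G] by (simp add: eq_diff_eq)

text \<open>
  Filtered operators are continuous for the topology of the degree filtration, in which the
  finite sums of monomials are dense.
\<close>

lemma additive_filtered_eq_0:
  fixes N :: "'a::group_add fls \<Rightarrow> 'b::group_add fls"
  assumes add: "\<And>F G. N (F + G) = N F + N G"
    and filt: "filtered N c"
    and monom: "\<And>f i. N (fls_monom f i) = 0"
  shows "N F = 0"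
proof -
  define m where "m = fls_subdegree F"
  have "\<exists>G. N F = N G \<and> vanishes_below (m + int k) G" for k
  proof (induction k)
    case 0
    show ?case using vanishes_below_subdegree[of F] by (auto simp: m_def)
  next
    case (Suc k)
    then obtain G where G: "N F = N G" "vanishes_below (m + int k) G" by blast
    have "N F = N (G - fls_monom (G $$ (m + int k)) (m + int k))"
      using G(1) by (simp add: additive_diff[of N] add monom)
    moreover have "vanishes_below (m + int (Suc k)) (G - fls_monom (G $$ (m + int k)) (m + int k))"
      using vanishes_below_diff_lead[OF G(2)] by (simp add: algebra_simps)
    ultimately show ?case by blast
  qed
  then have "vanishes_below ((m + c) + int k) (N F)" for k
    using filteredD[OF filt] by (metis add.assoc add.commute)
  then show ?thesis by (rule vanishes_below_all_eq_0)
qed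

corollary additive_filtered_eqI:
  fixes N M :: "'a::ab_group_add fls \<Rightarrow> 'b::ab_group_add fls"
  assumes "\<And>F G. N (F + G) = N F + N G" "\<And>F G. M (F + G) = M F + M G"
    and "filtered N c" "filtered M c"
    and "\<And>f i. N (fls_monom f i) = M (fls_monom f i)"
  shows "N F = M F"
proof -
  have "N F - M F = 0"
    by (rule additive_filtered_eq_0[of "\<lambda>F. N F - M F" c])
      (use assms in \<open>auto simp: filtered_def intro!: vanishes_below_diff\<close>)
  then show ?thesis by simp
qed

text \<open>
  The model is left multiplication by a series \<open>u y + \<dots>\<close> with \<open>u\<close> a unit.  The equivalence in
  the last clause controls the inverse as well, so that all integer powers are filtered.
\<close>

definition degree_one_operator :: "('a::comm_ring_1 fls \<Rightarrow> 'a fls) \<Rightarrow> bool"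
  where "degree_one_operator Y \<longleftrightarrow> bij Y \<and> (\<forall>F G. Y (F + G) = Y F + Y G) \<and>
    (\<forall>m F. vanishes_below (m + 1) (Y F) \<longleftrightarrow> vanishes_below m F)"

text \<open>
  Powers of a bijection with integer exponents; \<open>y_power_times\<close> is the case of \<open>y_times\<close>.
\<close>

definition int_funpow :: "('b \<Rightarrow> 'b) \<Rightarrow> int \<Rightarrow> 'b \<Rightarrow> 'b"
  where "int_funpow Y i = (if i \<ge> 0 then Y ^^ nat i else inv_into UNIV Y ^^ nat (- i))"

lemma y_power_times_eq: "y_power_times \<iota> \<delta> = int_funpow (y_times \<iota> \<delta>)"
  by (simp add: fun_eq_iff y_power_times_def int_funpow_def)

lemma int_funpow_0 [simp]: "int_funpow Y 0 H = H"
  by (simp add: int_funpow_def)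

lemma bij_apply_inv_into: "bij Y \<Longrightarrow> Y (inv_into UNIV Y H) = H"
  by (meson bij_is_surj surj_f_inv_f)

lemma bij_inv_into_apply: "bij Y \<Longrightarrow> inv_into UNIV Y (Y H) = H"
  by (meson bij_is_inj inv_f_f)

lemma int_funpow_plus_1:
  assumes "bij Y"
  shows "int_funpow Y (i + 1) H = Y (int_funpow Y i H)"
proof (cases i rule: int_cases)
  case (nonneg n)
  have "nat (i + 1) = Suc n" by (simp add: nonneg)
  then show ?thesis by (simp add: int_funpow_def nonneg)
next
  case (neg n)
  have "nat (- (i + 1)) = n" "nat (- i) = Suc n" by (simp_all add: neg)
  then show ?thesis
    by (cases "n = 0") (auto simp: int_funpow_def neg bij_apply_inv_into[OF assms])
qed

lemma int_funpow_minus_1: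
  assumes "bij Y"
  shows "int_funpow Y (i - 1) H = inv_into UNIV Y (int_funpow Y i H)"
  using int_funpow_plus_1[OF assms, of "i - 1" H] by (simp add: bij_inv_into_apply[OF assms])

lemma int_funpow_induct [case_names zero up down]:
  fixes P :: "int \<Rightarrow> bool"
  assumes "P 0" "\<And>i. P i \<Longrightarrow> P (i + 1)" "\<And>i. P i \<Longrightarrow> P (i - 1)"
  shows "P i"
  by (rule int_induct[of P 0]) (use assms in auto)

lemma int_funpow_swap:
  assumes "bij Y"
  shows "int_funpow Y i (Y H) = Y (int_funpow Y i H)"
proof (induction i rule: int_funpow_induct)
  case (down i)
  then show ?case using assms by (simp add: int_funpow_minus_1 bij_apply_inv_into bij_inv_into_apply)
qed (use assms in \<open>simp_all add: int_funpow_plus_1\<close>)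

lemma degree_one_operatorD:
  assumes "degree_one_operator Y"
  shows "bij Y" "Y (F + G) = Y F + Y G" "vanishes_below (m + 1) (Y F) \<longleftrightarrow> vanishes_below m F"
  using assms by (simp_all add: degree_one_operator_def)

lemma int_funpow_additive:
  assumes "degree_one_operator Y"
  shows "int_funpow Y i (F + G) = int_funpow Y i F + int_funpow Y i G"
proof (induction i rule: int_funpow_induct)
  case (up i)
  then show ?case by (simp add: int_funpow_plus_1 degree_one_operatorD[OF assms])
next
  case (down i)
  have "inv_into UNIV Y (A + B) = inv_into UNIV Y A + inv_into UNIV Y B" for A B
  proof -
    have "Y (inv_into UNIV Y A + inv_into UNIV Y B) = A + B"
      by (simp add: bij_apply_inv_into degree_one_operatorD[OF assms])
    then show ?thesis using bij_inv_into_apply[OF degree_one_operatorD(1)[OF assms]] by metis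
  qed
  with down show ?case by (simp add: int_funpow_minus_1 degree_one_operatorD[OF assms])
qed simp

lemma int_funpow_vanishes_below:
  assumes "degree_one_operator Y"
  shows "vanishes_below (m + i) (int_funpow Y i H) \<longleftrightarrow> vanishes_below m H"
proof (induction i rule: int_funpow_induct)
  case (up i)
  then show ?case
    using degree_one_operatorD(3)[OF assms, of "m + i"] degree_one_operatorD(1)[OF assms]
    by (simp add: int_funpow_plus_1 add.assoc)
next
  case (down i)
  then show ?case
    using degree_one_operatorD(3)[OF assms, of "m + (i - 1)"]
      int_funpow_plus_1[OF degree_one_operatorD(1)[OF assms], of "i - 1" H]
    by (simp add: algebra_simps)
qed simp

section \<open>Evaluating Laurent series at an operator\<close>

definition laurent_eval ::
    "('a::zero \<Rightarrow> 'b) \<Rightarrow> ('b fls \<Rightarrow> 'b fls) \<Rightarrow> 'a fls \<Rightarrow> 'b::comm_ring_1 fls \<Rightarrow> 'b fls"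
  where "laurent_eval \<alpha> Y F H = Abs_fls (\<lambda>n.
    \<Sum>i \<in> {fls_subdegree F .. n - fls_subdegree H}. \<alpha> (F $$ i) * int_funpow Y i H $$ n)"

lemma pdo_mult_eq: "pdo_mult \<iota> \<delta> F G = laurent_eval (\<lambda>f. f) (y_times \<iota> \<delta>) F G"
  by (simp add: pdo_mult_def laurent_eval_def y_power_times_eq)

context
  fixes \<alpha> :: "'a::comm_ring_1 \<Rightarrow> 'b::comm_ring_1" and Y :: "'b fls \<Rightarrow> 'b fls"
  assumes \<alpha>_add: "\<And>f g. \<alpha> (f + g) = \<alpha> f + \<alpha> g"
    and Y: "degree_one_operator Y"
begin

lemma laurent_eval_nth:
  assumes "vanishes_below m F" "vanishes_below k H"
  shows "laurent_eval \<alpha> Y F H $$ n = (\<Sum>i = m..n - k. \<alpha> (F $$ i) * int_funpow Y i H $$ n)"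
proof -
  have zero: "\<alpha> (F $$ i) * int_funpow Y i H $$ n = 0"
    if "\<not> (fls_subdegree F \<le> i \<and> i \<le> n - fls_subdegree H) \<or> \<not> (m \<le> i \<and> i \<le> n - k)" for i n
  proof -
    have "F $$ i = 0 \<or> n < fls_subdegree H + i \<or> n < k + i"
      using that assms(1) by (auto simp: vanishes_below_def)
    moreover have "int_funpow Y i H $$ n = 0" if "n < fls_subdegree H + i \<or> n < k + i"
      using that int_funpow_vanishes_below[OF Y] vanishes_below_subdegree[of H] assms(2)
      by (blast intro: vanishes_belowD)
    ultimately show ?thesis using additive_0[of \<alpha>, OF \<alpha>_add] by auto
  qed
  have "laurent_eval \<alpha> Y F H $$ n =
    (\<Sum>i \<in> {fls_subdegree F .. n - fls_subdegree H}. \<alpha> (F $$ i) * int_funpow Y i H $$ n)"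
    unfolding laurent_eval_def
    by (rule nth_Abs_fls_lower_bound[of "fls_subdegree F + fls_subdegree H"]) simp
  also have "\<dots> = (\<Sum>i \<in> {fls_subdegree F .. n - fls_subdegree H} \<union> {m..n - k}.
      \<alpha> (F $$ i) * int_funpow Y i H $$ n)"
    by (rule sum.mono_neutral_left) (use zero[of _ n] in auto)
  also have "\<dots> = (\<Sum>i = m..n - k. \<alpha> (F $$ i) * int_funpow Y i H $$ n)"
    by (rule sum.mono_neutral_right) (use zero[of _ n] in auto)
  finally show ?thesis .
qed

lemma laurent_eval_vanishes_below:
  assumes "vanishes_below m F" "vanishes_below k H"
  shows "vanishes_below (m + k) (laurent_eval \<alpha> Y F H)"
  by (rule vanishes_belowI) (simp add: laurent_eval_nth[OF assms])

lemma laurent_eval_filtered: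
  assumes "vanishes_below k H"
  shows "filtered (\<lambda>F. laurent_eval \<alpha> Y F H) k"
  using assms by (simp add: filtered_def laurent_eval_vanishes_below)

lemma laurent_eval_add_left:
  "laurent_eval \<alpha> Y (F + G) H = laurent_eval \<alpha> Y F H + laurent_eval \<alpha> Y G H"
proof (rule fls_eqI)
  fix n
  define m where "m = min (fls_subdegree F) (fls_subdegree G)"
  have vb: "vanishes_below m F" "vanishes_below m G" "vanishes_below m (F + G)"
    by (auto simp: m_def vanishes_below_def)
  show "laurent_eval \<alpha> Y (F + G) H $$ n = (laurent_eval \<alpha> Y F H + laurent_eval \<alpha> Y G H) $$ n"
    by (simp add: vb[THEN laurent_eval_nth, OF vanishes_below_subdegree] \<alpha>_add
        distrib_right sum.distrib)
qed

lemma laurent_eval_add_right: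
  "laurent_eval \<alpha> Y F (G + H) = laurent_eval \<alpha> Y F G + laurent_eval \<alpha> Y F H"
proof (rule fls_eqI)
  fix n
  define m where "m = min (fls_subdegree G) (fls_subdegree H)"
  have vb: "vanishes_below m G" "vanishes_below m H" "vanishes_below m (G + H)"
    by (auto simp: m_def vanishes_below_def)
  show "laurent_eval \<alpha> Y F (G + H) $$ n = (laurent_eval \<alpha> Y F G + laurent_eval \<alpha> Y F H) $$ n"
    by (simp add: vb[THEN laurent_eval_nth[OF vanishes_below_subdegree]] int_funpow_additive[OF Y]
        distrib_left sum.distrib)
qed

lemma laurent_eval_monom:
  "laurent_eval \<alpha> Y (fls_monom f i) H = fls_const (\<alpha> f) * int_funpow Y i H"
proof (rule fls_eqI)
  fix n
  define k where "k = min (fls_subdegree H) (n - i)"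
  have k: "vanishes_below k H" "i \<le> n - k" by (auto simp: k_def vanishes_below_def)
  have "laurent_eval \<alpha> Y (fls_monom f i) H $$ n =
    (\<Sum>j = i..n - k. \<alpha> (fls_monom f i $$ j) * int_funpow Y j H $$ n)"
    by (rule laurent_eval_nth) (simp_all add: k)
  also have "\<dots> = (\<Sum>j \<in> {i}. \<alpha> (fls_monom f i $$ j) * int_funpow Y j H $$ n)"
    by (rule sum.mono_neutral_right) (use k in \<open>auto simp: additive_0[of \<alpha>, OF \<alpha>_add]\<close>)
  finally show "laurent_eval \<alpha> Y (fls_monom f i) H $$ n =
      (fls_const (\<alpha> f) * int_funpow Y i H) $$ n"
    by simp
qed

text \<open>Multiplying \<open>F\<close> by \<open>y\<close> on the right inserts one more \<open>Y\<close> before \<open>H\<close>.\<close>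

lemma laurent_eval_shift:
  "laurent_eval \<alpha> Y (fls_shift (- 1) F) H = laurent_eval \<alpha> Y F (Y H)"
proof -
  obtain k where k: "vanishes_below k H" using vanishes_below_subdegree by blast
  have Yk: "vanishes_below (k + 1) (Y H)" using k degree_one_operatorD(3)[OF Y] by simp
  show ?thesis
  proof (rule additive_filtered_eqI[where c = "k + 1" and
        N = "\<lambda>F. laurent_eval \<alpha> Y (fls_shift (- 1) F) H" and
        M = "\<lambda>F. laurent_eval \<alpha> Y F (Y H)"])
    show "filtered (\<lambda>F. laurent_eval \<alpha> Y (fls_shift (- 1) F) H) (k + 1)"
      unfolding filtered_def
    proof (intro allI impI)
      fix m and F :: "'a fls" assume "vanishes_below m F"
      then show "vanishes_below (m + (k + 1)) (laurent_eval \<alpha> Y (fls_shift (- 1) F) H)"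
        using laurent_eval_vanishes_below[of "m + 1" "fls_shift (- 1) F" k H] k
        by (simp add: vanishes_below_shift algebra_simps)
    qed
  qed (use Yk in \<open>simp_all add: laurent_eval_add_left laurent_eval_filtered laurent_eval_monom
      int_funpow_plus_1 int_funpow_swap degree_one_operatorD(1)[OF Y]\<close>)
qed

end

section \<open>The ring of quadratic formal pseudodifferential operators\<close>

text \<open>The central binomial series is \<open>(1 - 2 X)\<^bsup>-1/2\<^esup>\<close>, since it solves \<open>(1 - 2 X) a' = a\<close>.\<close>

lemma central_binomial_series_square:
  fixes a :: "rat fps"
  assumes a: "a = Abs_fps (\<lambda>k. fact (2 * k) / (2 ^ k * (fact k)\<^sup>2))"
  shows "a * a * (1 - 2 * fps_X) = 1"
proof -
  define b :: "rat fps" where "b = 1 - 2 * fps_X"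
  have rec: "of_nat (Suc k) * fps_nth a (Suc k) = (2 * of_nat k + 1) * fps_nth a k" for k
    by (simp add: a field_simps power2_eq_square del: of_nat_Suc) (simp add: algebra_simps)
  have ode: "b * fps_deriv a = a"
  proof (rule fps_ext)
    fix k
    have "fps_nth (b * fps_deriv a) k = fps_nth (fps_deriv a) k
        - 2 * fps_nth (fps_X * fps_deriv a) k"
      by (simp only: b_def left_diff_distrib mult.assoc numeral_fps_const fps_mult_left_const_nth
          fps_sub_nth mult_1)
    also have "\<dots> = fps_nth a k"
    proof (cases k)
      case 0
      then show ?thesis using rec[of 0] by simp
    next
      case (Suc j)
      then show ?thesis using rec[of k] by (simp add: algebra_simps)
    qed
    finally show "fps_nth (b * fps_deriv a) k = fps_nth a k" .
  qed
  have "fps_deriv (a * a * b) = 2 * a * (b * fps_deriv a) - 2 * a * a"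
    by (simp add: b_def algebra_simps)
  then have "fps_deriv (a * a * b) = 0"
    by (simp add: ode mult.assoc)
  then have "a * a * b = fps_const (fps_nth (a * a * b) 0)"
    by (simp only: fps_deriv_eq_0_iff)
  also have "fps_nth (a * a * b) 0 = 1"
    by (simp add: a b_def)
  finally show ?thesis by (simp add: b_def)
qed

locale quadratic_pdo =
  fixes \<iota> :: "rat \<Rightarrow> 'a::{idom, ring_char_0}" and d :: "'a \<Rightarrow> 'a"
  assumes \<iota>: "rational_embedding \<iota>" and d: "derivation d"
begin

definition \<delta> :: "'a \<Rightarrow> 'a"
  where "\<delta> f = \<iota> (1 / 2) * d f"

text \<open>Left multiplication by \<open>y\<close>.\<close>

abbreviation L :: "'a fls \<Rightarrow> 'a fls"
  where "L \<equiv> y_times \<iota> \<delta>"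

abbreviation pdo_times :: "'a fls \<Rightarrow> 'a fls \<Rightarrow> 'a fls" (infixl "\<star>" 70)
  where "F \<star> G \<equiv> pdo_mult \<iota> \<delta> F G"

abbreviation sum_shift :: "rat fps \<Rightarrow> 'a fls \<Rightarrow> 'a fls"
  where "sum_shift \<equiv> even_shift_sum \<iota> \<delta>"

lemma d_add: "d (f + g) = d f + d g" and d_mult: "d (f * g) = d f * g + f * d g"
  using d by (simp_all add: derivation_def)

lemma d_0 [simp]: "d 0 = 0"
  by (rule derivation_0[OF d])

lemma d_1 [simp]: "d 1 = 0"
  using d_mult[of 1 1] by simp

lemma half: "\<iota> (1 / 2) * 2 = 1" "2 * \<iota> (1 / 2) = 1"
proof -
  show "\<iota> (1 / 2) * 2 = 1"
    using rational_embeddingD(1)[OF \<iota>, of "1 / 2" "1 / 2"] rational_embeddingD(3)[OF \<iota>]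
    by (simp add: mult_2_right)
  then show "2 * \<iota> (1 / 2) = 1" by (simp add: mult.commute)
qed

lemma half_cancel [simp]: "2 * (\<iota> (1 / 2) * f) = f"
  using half by (simp flip: mult.assoc)

lemma derivation_\<delta>: "derivation \<delta>"
  by (simp add: derivation_def \<delta>_def d_add d_mult algebra_simps)

lemma \<delta>_0 [simp]: "\<delta> 0 = 0"
  by (rule derivation_0[OF derivation_\<delta>])

lemma two_\<delta> [simp]: "2 * \<delta> f = d f"
  by (simp add: \<delta>_def)

lemma sum_shift_nth:
  assumes "vanishes_below m G" "n < m + 2 * int N"
  shows "sum_shift a G $$ n = (\<Sum>k<N. \<iota> (fps_nth a k) * (\<delta> ^^ k) (G $$ (n - 2 * int k)))"
  using assms by (intro even_shift_sum_nth'[OF derivation_\<delta> \<iota>, of m]) (auto simp: vanishes_below_def)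

lemma sum_shift_vanishes_below: "vanishes_below m G \<Longrightarrow> vanishes_below m (sum_shift a G)"
  by (rule vanishes_belowI) (simp add: sum_shift_nth[where N = 0])

lemma sum_shift_shift: "sum_shift a (fls_shift j G) = fls_shift j (sum_shift a G)"
proof (rule fls_eqI)
  fix n
  define m where "m = fls_subdegree G"
  define N where "N = nat (n + j - m) + 1"
  have m: "vanishes_below m G" "vanishes_below (m - j) (fls_shift j G)"
    by (simp_all add: m_def vanishes_below_subdegree vanishes_below_shift)
  have N: "n + j < m + 2 * int N" "n < m - j + 2 * int N" by (simp_all add: N_def)
  show "sum_shift a (fls_shift j G) $$ n = fls_shift j (sum_shift a G) $$ n"
    unfolding fls_shift_nth sum_shift_nth[OF m(1) N(1)] sum_shift_nth[OF m(2) N(2)]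
    by (simp add: algebra_simps)
qed

lemma sum_shift_add: "sum_shift a (F + G) = sum_shift a F + sum_shift a G"
proof (rule fls_eqI)
  fix n
  define m where "m = min (fls_subdegree F) (fls_subdegree G)"
  define N where "N = nat (n - m) + 1"
  have vb: "vanishes_below m F" "vanishes_below m G" "vanishes_below m (F + G)"
    by (auto simp: m_def vanishes_below_def)
  have N: "n < m + 2 * int N" by (simp add: N_def)
  show "sum_shift a (F + G) $$ n = (sum_shift a F + sum_shift a G) $$ n"
    by (simp add: vb[THEN sum_shift_nth, OF N] pow_add[OF derivation_\<delta> \<iota>] distrib_left sum.distrib)
qed

definition y_series :: "rat fps"
  where "y_series = Abs_fps (\<lambda>k. fact (2 * k) / (2 ^ k * (fact k)\<^sup>2))"

lemma L_eq: "L G = fls_shift (- 1) (sum_shift y_series G)"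
  unfolding y_series_def by (rule y_times_eq[OF derivation_\<delta> \<iota>])

lemma sum_shift_inverse: "sum_shift (inverse y_series) (sum_shift y_series G) = G"
proof -
  have "inverse y_series * y_series = 1"
    by (simp add: y_series_def inverse_mult_eq_1)
  then show ?thesis by (simp add: even_shift_sum_mult[OF derivation_\<delta> \<iota>] even_shift_sum_1[OF derivation_\<delta> \<iota>])
qed

lemma L_degree_one: "degree_one_operator L"
  unfolding degree_one_operator_def
proof (intro conjI allI)
  show "bij L" by (rule bij_y_times[OF derivation_\<delta> \<iota>])
  show "L (F + G) = L F + L G" for F G
    by (simp add: L_eq sum_shift_add)
  show "vanishes_below (m + 1) (L F) \<longleftrightarrow> vanishes_below m F" for m F
    using sum_shift_vanishes_below[of m F y_series]
      sum_shift_vanishes_below[of m "sum_shift y_series F" "inverse y_series"]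
    by (auto simp: L_eq vanishes_below_shift sum_shift_inverse)
qed

lemmas bij_L = degree_one_operatorD(1)[OF L_degree_one]
lemmas L_add = degree_one_operatorD(2)[OF L_degree_one]
lemmas L_vanishes_below = degree_one_operatorD(3)[OF L_degree_one]

text \<open>
  Left multiplication by \<open>x\<inverse>\<close>, where \<open>x = y\<^sup>2\<close>.  Unlike multiplication by \<open>x\<close> or \<open>y\<close> it involves
  no infinite sum: the commutation law of \<open>x\<close> is equivalent to \<open>x\<inverse> f = f x\<inverse> - d f\<close>.
\<close>

definition t_times :: "'a fls \<Rightarrow> 'a fls"
  where "t_times G = Abs_fls (\<lambda>n. G $$ (n + 2) - d (G $$ n))"

lemma t_times_nth: "t_times G $$ n = G $$ (n + 2) - d (G $$ n)"
  unfolding t_times_def by (rule nth_Abs_fls_lower_bound[of "fls_subdegree G - 2"]) simp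

lemma t_times_eq: "t_times G = fls_shift 2 (sum_shift (1 - 2 * fps_X) G)"
proof (rule fls_eqI)
  fix n
  define m where "m = fls_subdegree G"
  define N where "N = nat (n + 2 - m) + 2"
  have m: "vanishes_below m G" by (simp add: m_def vanishes_below_subdegree)
  have N: "n + 2 < m + 2 * int N" by (simp add: N_def)
  define b :: "rat fps" where "b = 1 - 2 * fps_X"
  have nth: "fps_nth b k = (if k = 0 then 1 else if k = 1 then - 2 else 0)" for k
    by (auto simp: b_def numeral_fps_const)
  have "\<iota> (- 1) = - 1"
    using rational_embeddingD(1)[OF \<iota>, of "- 1" "1"] rational_embeddingD(3,4)[OF \<iota>]
    by (simp add: eq_neg_iff_add_eq_0)
  then have \<iota>2: "\<iota> (- 2) = - 2"
    using rational_embeddingD(1)[OF \<iota>, of "- 1" "- 1"] by simp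
  have "sum_shift b G $$ (n + 2) = (\<Sum>k<N. \<iota> (fps_nth b k) *
      (\<delta> ^^ k) (G $$ (n + 2 - 2 * int k)))"
    by (rule sum_shift_nth[OF m N])
  also have "\<dots> = (\<Sum>k\<in>{0, 1}. \<iota> (fps_nth b k) *
      (\<delta> ^^ k) (G $$ (n + 2 - 2 * int k)))"
    by (rule sum.mono_neutral_right) (auto simp: N_def nth rational_embeddingD[OF \<iota>])
  also have "\<dots> = G $$ (n + 2) - d (G $$ n)"
    by (simp add: nth rational_embeddingD[OF \<iota>] \<iota>2)
  finally show "t_times G $$ n = fls_shift 2 (sum_shift (1 - 2 * fps_X) G) $$ n"
    by (simp add: t_times_nth b_def)
qed

lemma L_L_t_times: "L (L (t_times G)) = G" and t_times_L_L: "t_times (L (L G)) = G"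
proof -
  note [simp] = L_eq t_times_eq sum_shift_shift even_shift_sum_mult[OF derivation_\<delta> \<iota>]
  have eq: "y_series * y_series * (1 - 2 * fps_X) = 1"
    by (rule central_binomial_series_square) (rule y_series_def)
  then have eq': "(1 - 2 * fps_X) * (y_series * y_series) = 1"
    by (simp add: mult.commute)
  have "L (L (t_times G)) = sum_shift (y_series * y_series * (1 - 2 * fps_X)) G"
    by (simp add: mult.assoc)
  then show "L (L (t_times G)) = G" by (simp only: eq even_shift_sum_1[OF derivation_\<delta> \<iota>])
  have "t_times (L (L G)) = sum_shift ((1 - 2 * fps_X) * (y_series * y_series)) G"
    by simp
  then show "t_times (L (L G)) = G" by (simp only: eq' even_shift_sum_1[OF derivation_\<delta> \<iota>])
qed

lemma t_times_monom: "t_times (fls_monom f i) = fls_monom f (i - 2) - fls_monom (d f) i"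
  by (rule fls_eqI) (auto simp: t_times_nth)

lemma t_times_const_mult: "t_times (fls_const g * H) = fls_const g * t_times H - fls_const (d g) * H"
  by (rule fls_eqI) (simp add: t_times_nth d_mult algebra_simps)

lemma t_times_add: "t_times (F + G) = t_times F + t_times G"
  by (rule fls_eqI) (simp add: t_times_nth d_add)

lemma t_times_vanishes_below: "vanishes_below m F \<Longrightarrow> vanishes_below (m - 2) (t_times F)"
  by (simp add: vanishes_below_def t_times_nth)

lemma L_shift: "L (fls_shift j G) = fls_shift j (L G)"
  by (simp add: L_eq sum_shift_shift add.commute)

text \<open>The first coefficients of \<open>y G\<close>: in lowest degrees \<open>y\<close> acts like a central variable.\<close>

lemma L_leading:
  assumes "vanishes_below m G"
  shows "L G $$ (m + 1) = G $$ m" "L G $$ (m + 2) = G $$ (m + 1)"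
    "L G $$ (m + 3) = G $$ (m + 2) + \<delta> (G $$ m)"
proof -
  have a: "fps_nth y_series 0 = 1" "fps_nth y_series (Suc 0) = 1"
    by (simp_all add: y_series_def fact_2)
  note nth = sum_shift_nth[OF assms, of _ _ y_series]
  show "L G $$ (m + 1) = G $$ m" "L G $$ (m + 2) = G $$ (m + 1)"
    by (simp_all add: L_eq nth[where N = 1] a rational_embeddingD[OF \<iota>] add.commute)
  show "L G $$ (m + 3) = G $$ (m + 2) + \<delta> (G $$ m)"
    by (simp add: L_eq nth[where N = 2] a rational_embeddingD[OF \<iota>] numeral_2_eq_2 add.commute)
qed

lemma L_minus_shift_vanishes_below:
  assumes "vanishes_below m G"
  shows "vanishes_below (m + 2) (L G - fls_shift (- 1) G)"
proof -
  have "vanishes_below (m + 1) (L G - fls_shift (- 1) G)"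
    using assms by (intro vanishes_below_diff) (simp_all add: L_vanishes_below vanishes_below_shift)
  then have "vanishes_below (m + 1 + 1) (L G - fls_shift (- 1) G)"
    by (rule vanishes_below_Suc) (simp add: L_leading[OF assms])
  then show ?thesis by (simp add: add.assoc)
qed

lemma L_power_vanishes_below: "vanishes_below (m + i) (int_funpow L i G) \<longleftrightarrow> vanishes_below m G"
  by (rule int_funpow_vanishes_below[OF L_degree_one])

text \<open>
  In the product notation: \<open>y\<^sup>i g = g y\<^sup>i + i \<delta>(g) y\<^bsup>i+2\<^esup> + \<dots>\<close>.  The coefficient \<open>i\<close> detects the
  degree of a monomial through its commutators, which is what determines extensions of automorphisms.
\<close>

lemma L_power_leading:
  assumes "vanishes_below m G"
  shows "int_funpow L i G $$ (m + i) = G $$ m \<and> int_funpow L i G $$ (m + i + 1) = G $$ (m + 1) \<and>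
    int_funpow L i G $$ (m + i + 2) = G $$ (m + 2) + of_int i * \<delta> (G $$ m)"
proof (induction i rule: int_funpow_induct)
  case zero
  show ?case by simp
next
  case (up i)
  have "vanishes_below (m + i) (int_funpow L i G)" by (simp add: L_power_vanishes_below assms)
  from L_leading[OF this] up show ?case
    unfolding int_funpow_plus_1[OF bij_L] by (simp add: algebra_simps)
next
  case (down i)
  have eq: "L (int_funpow L (i - 1) G) = int_funpow L i G"
    using int_funpow_plus_1[OF bij_L, of "i - 1" G] by simp
  have vb: "vanishes_below (m + (i - 1)) (int_funpow L (i - 1) G)"
    by (simp only: L_power_vanishes_below assms)
  from L_leading[OF vb] have "int_funpow L (i - 1) G $$ (m + i - 1) = int_funpow L i G $$ (m + i)"
    "int_funpow L (i - 1) G $$ (m + i) = int_funpow L i G $$ (m + i + 1)"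
    "int_funpow L (i - 1) G $$ (m + i + 1) + \<delta> (int_funpow L (i - 1) G $$ (m + i - 1)) =
      int_funpow L i G $$ (m + i + 2)"
    by (simp_all add: eq algebra_simps)
  with down show ?case by (simp add: algebra_simps)
qed

lemma L_power_monom_1: "int_funpow L i (fls_monom 1 j) = fls_monom 1 (i + j)"
proof -
  have L: "L (fls_monom 1 k) = fls_monom 1 (k + 1)" for k
  proof -
    have "\<delta> 1 = 0" by (simp add: \<delta>_def)
    then have pow: "(\<delta> ^^ n) 1 = (if n = 0 then 1 else 0)" for n
      by (induction n) auto
    show ?thesis
    proof (rule fls_eqI)
      fix n
      define N where "N = nat (n - k) + 1"
      have "vanishes_below k (fls_monom (1::'a) k)" "n - 1 < k + 2 * int N" by (simp_all add: N_def)
      then have "L (fls_monom 1 k) $$ n =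
          (\<Sum>l<N. \<iota> (fps_nth y_series l) * (\<delta> ^^ l) (fls_monom 1 k $$ (n - 1 - 2 * int l)))"
        using sum_shift_nth[of k "fls_monom 1 k" "n - 1" N y_series]
        by (simp only: L_eq fls_shift_nth add_uminus_conv_diff)
      also have "\<dots> = (\<Sum>l\<in>{0}. \<iota> (fps_nth y_series l) *
          (\<delta> ^^ l) (fls_monom 1 k $$ (n - 1 - 2 * int l)))"
        by (rule sum.mono_neutral_right) (auto simp: N_def pow pow_0[OF derivation_\<delta> \<iota>])
      also have "\<dots> = fls_monom 1 (k + 1) $$ n"
        by (auto simp: y_series_def rational_embeddingD[OF \<iota>])
      finally show "L (fls_monom 1 k) $$ n = fls_monom 1 (k + 1) $$ n" .
    qed
  qed
  show ?thesis
  proof (induction i rule: int_funpow_induct)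
    case (up i)
    then show ?case unfolding int_funpow_plus_1[OF bij_L] by (simp add: L algebra_simps)
  next
    case (down i)
    have "inv_into UNIV L (L (fls_monom 1 (i + j - 1))) = fls_monom 1 (i + j - 1)"
      by (rule bij_inv_into_apply[OF bij_L])
    with down show ?case unfolding int_funpow_minus_1[OF bij_L] by (simp add: L algebra_simps)
  qed simp
qed

text \<open>
  The engine of the whole development, used once for associativity and once for the extension of
  automorphisms.  If conjugation by \<open>Y\<^sup>2\<close> acts on the coefficients as conjugation by \<open>y\<^sup>2\<close> does
  on \<open>R\<close>, then the square roots \<open>Y\<close> and \<open>y\<close> correspond as well.  Indeed, the defect
  \<open>N G = Y E(G) - E(y G)\<close>, where \<open>E\<close> is evaluation at \<open>Y\<close>, satisfies
  \<open>Y N(G) + N(y G) = 0\<close>.  To leading order this reads \<open>2 Y N(G) = 0\<close>, so the degree of \<open>N\<close> can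
  be raised without end.  The last assumption says that \<open>Y\<close> and \<open>N G\<close> commute to leading order.
\<close>

lemma laurent_eval_L:
  fixes \<alpha> :: "'a \<Rightarrow> 'a" and Y T' :: "'a fls \<Rightarrow> 'a fls"
  defines "E \<equiv> laurent_eval \<alpha> Y"
  assumes \<alpha>: "\<And>f g. \<alpha> (f + g) = \<alpha> f + \<alpha> g"
    and Y: "degree_one_operator Y"
    and T'_Y: "\<And>H. T' (Y (Y H)) = H" and Y_T': "\<And>H. Y (Y (T' H)) = H"
    and T'_const: "\<And>g H. T' (fls_const (\<alpha> g) * H) =
      fls_const (\<alpha> g) * T' H - fls_const (\<alpha> (d g)) * H"
    and comm: "\<And>G n k H. (\<And>k H. vanishes_below k H \<Longrightarrow>
        vanishes_below (k + n) (Y (E G H) - E (L G) H)) \<Longrightarrow> vanishes_below k H \<Longrightarrow>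
      vanishes_below (k + n + 2)
        (Y (Y (E G H) - E (L G) H) - (Y (E G (Y H)) - E (L G) (Y H)))"
  shows "E (L G) H = Y (E G H)"
proof -
  note Y_bij = degree_one_operatorD(1)[OF Y] and Y_add = degree_one_operatorD(2)[OF Y]
    and Y_vb = degree_one_operatorD(3)[OF Y]
  note Y_diff = additive_diff[of Y, OF Y_add]
  note E_add = laurent_eval_add_left[of \<alpha> Y, OF \<alpha> Y, folded E_def]
  note E_diff = additive_diff[of "\<lambda>G. E G H" for H, OF E_add]
  note E_vb = laurent_eval_vanishes_below[of \<alpha> Y, OF \<alpha> Y, folded E_def]
  note E_monom = laurent_eval_monom[of \<alpha> Y, OF \<alpha> Y, folded E_def]
  note E_shift = laurent_eval_shift[of \<alpha> Y, OF \<alpha> Y, folded E_def]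
  define N where "N G H = Y (E G H) - E (L G) H" for G H
  have N_diff: "N (F - G) H = N F H - N G H" for F G H
    by (simp add: N_def Y_diff E_diff additive_diff[of L, OF L_add] algebra_simps)
  have YY_E_T: "Y (Y (E (t_times G) H)) = E G H" for G H
  proof -
    obtain k where k: "vanishes_below k H" using vanishes_below_subdegree by blast
    show ?thesis
    proof (rule additive_filtered_eqI[where c = k and N = "\<lambda>G. Y (Y (E (t_times G) H))" and M = "\<lambda>G. E G H"])
      show "filtered (\<lambda>G. E G H) k"
        using k by (simp add: filtered_def E_vb)
      show "filtered (\<lambda>G. Y (Y (E (t_times G) H))) k"
        unfolding filtered_def
      proof (intro allI impI)
        fix m and G :: "'a fls" assume "vanishes_below m G"
        then have "vanishes_below (m - 2 + k) (E (t_times G) H)"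
          by (intro E_vb t_times_vanishes_below k)
        then have "vanishes_below (m - 2 + k + 1 + 1) (Y (Y (E (t_times G) H)))"
          by (simp only: Y_vb)
        then show "vanishes_below (m + k) (Y (Y (E (t_times G) H)))" by simp
      qed
      show "Y (Y (E (t_times (fls_monom f i)) H)) = E (fls_monom f i) H" for f i
      proof -
        have "T' (int_funpow Y i H) = int_funpow Y (i - 2) H"
          using T'_Y[of "int_funpow Y (i - 2) H"] int_funpow_plus_1[OF Y_bij, of "i - 2" H]
            int_funpow_plus_1[OF Y_bij, of "i - 1" H] by simp
        then have "E (t_times (fls_monom f i)) H = T' (fls_const (\<alpha> f) * int_funpow Y i H)"
          by (simp add: t_times_monom E_diff E_monom T'_const)
        then show ?thesis by (simp add: Y_T' E_monom)
      qed
    qed (simp_all add: t_times_add E_add Y_add)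
  qed
  have anti: "Y (N G H) + N (L G) H = 0" for G H
    using YY_E_T[of "L (L G)" H] by (simp add: N_def Y_diff t_times_L_L)
  have N_shift: "N (fls_shift (- 1) G) H = N G (Y H)" for G H
    by (simp add: N_def E_shift L_shift)
  have "vanishes_below (j + k + 1 + int n) (N G H)"
    if "vanishes_below j G" "vanishes_below k H" for j k n G H
    using that
  proof (induction n arbitrary: j k G H)
    case 0
    then have "vanishes_below (j + k + 1) (Y (E G H))" "vanishes_below (j + 1 + k) (E (L G) H)"
      by (simp_all add: Y_vb E_vb L_vanishes_below)
    then show ?case by (simp add: N_def algebra_simps vanishes_below_diff)
  next
    case (Suc n)
    have 1: "vanishes_below (k + (j + 1 + int n) + 2) (Y (N G H) - N G (Y H))"
      unfolding N_def
    proof (rule comm)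
      fix k and H :: "'a fls" assume "vanishes_below k H"
      from Suc.IH[OF Suc.prems(1) this]
      show "vanishes_below (k + (j + 1 + int n)) (Y (E G H) - E (L G) H)"
        by (simp add: N_def algebra_simps)
    qed (fact Suc.prems(2))
    have 2: "vanishes_below ((j + 2) + k + 1 + int n) (N (L G - fls_shift (- 1) G) H)"
      by (rule Suc.IH) (use Suc.prems in \<open>simp_all add: L_minus_shift_vanishes_below\<close>)
    have "2 * Y (N G H) = (Y (N G H) - N G (Y H)) - N (L G - fls_shift (- 1) G) H"
      using anti[of G H] by (simp add: N_diff N_shift algebra_simps eq_neg_iff_add_eq_0)
    moreover have "vanishes_below (j + k + int n + 3)
        ((Y (N G H) - N G (Y H)) - N (L G - fls_shift (- 1) G) H)"
      using 1 2 by (intro vanishes_below_diff[of _ "Y (N G H) - N G (Y H)"])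
        (simp_all add: algebra_simps)
    ultimately have "vanishes_below (j + k + int n + 3) (2 * Y (N G H))" by (simp only:)
    from vanishes_below_double[OF this]
    have "vanishes_below (j + k + int n + 2 + 1) (Y (N G H))" by (simp add: add.assoc)
    then have "vanishes_below (j + k + int n + 2) (N G H)"
      by (simp only: Y_vb)
    then show ?case by (simp add: algebra_simps)
  qed
  from vanishes_below_all_eq_0[OF this, OF vanishes_below_subdegree vanishes_below_subdegree]
  have "N G H = 0" .
  then show ?thesis by (simp add: N_def)
qed

text \<open>Evaluation at such an operator \<open>Y\<close> is multiplicative; for \<open>Y = L\<close> this is associativity.\<close>

lemma laurent_eval_mult:
  assumes \<alpha>: "\<And>f g. \<alpha> (f + g) = \<alpha> f + \<alpha> g" "\<And>f g. \<alpha> (f * g) = \<alpha> f * \<alpha> g"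
    and Y: "degree_one_operator Y"
    and E_L: "\<And>G H. laurent_eval \<alpha> Y (L G) H = Y (laurent_eval \<alpha> Y G H)"
  shows "laurent_eval \<alpha> Y (F \<star> G) H = laurent_eval \<alpha> Y F (laurent_eval \<alpha> Y G H)"
proof -
  define E where "E = laurent_eval \<alpha> Y"
  note E_add = laurent_eval_add_left[of \<alpha> Y, OF \<alpha>(1) Y, folded E_def]
  note E_vb = laurent_eval_vanishes_below[of \<alpha> Y, OF \<alpha>(1) Y, folded E_def]
  note E_monom = laurent_eval_monom[of \<alpha> Y, OF \<alpha>(1) Y, folded E_def]
  note star_monom = laurent_eval_monom[of "\<lambda>f. f" L, OF refl L_degree_one, folded pdo_mult_eq]
  note star_add = laurent_eval_add_left[of "\<lambda>f. f" L, OF refl L_degree_one, folded pdo_mult_eq]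
  note star_vb = laurent_eval_vanishes_below[of "\<lambda>f. f" L, OF refl L_degree_one, folded pdo_mult_eq]
  note Y_bij = degree_one_operatorD(1)[OF Y]
  note E_L = E_L[folded E_def]
  obtain k l where kl: "vanishes_below k G" "vanishes_below l H"
    by (rule that) (rule vanishes_below_subdegree)+
  have E_L_power: "E (int_funpow L i G) H = int_funpow Y i (E G H)" for i
  proof (induction i rule: int_funpow_induct)
    case (up i)
    then show ?case by (simp add: int_funpow_plus_1[OF Y_bij] int_funpow_plus_1[OF bij_L] E_L)
  next
    case (down i)
    have "Y (E (int_funpow L (i - 1) G) H) = int_funpow Y i (E G H)"
      using int_funpow_plus_1[OF bij_L, of "i - 1" G]
      unfolding E_L[symmetric] down[symmetric] by simp
    then have "inv_into UNIV Y (Y (E (int_funpow L (i - 1) G) H)) = int_funpow Y (i - 1) (E G H)"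
      by (simp only: int_funpow_minus_1[OF Y_bij])
    then show ?case by (simp only: bij_inv_into_apply[OF Y_bij])
  qed simp
  have E_const: "E (fls_const f * G) H = fls_const (\<alpha> f) * E G H" for f G
  proof (rule additive_filtered_eqI[where c = l and N = "\<lambda>G. E (fls_const f * G) H"
        and M = "\<lambda>G. fls_const (\<alpha> f) * E G H"])
    show "E (fls_const f * fls_monom g i) H = fls_const (\<alpha> f) * E (fls_monom g i) H" for g i
      by (simp add: E_monom \<alpha>(2) mult.assoc flip: fls_const_mult_const)
  qed (simp_all add: E_add distrib_left filtered_def E_vb vanishes_below_const_mult kl)
  have "E (F \<star> G) H = E F (E G H)"
  proof (rule additive_filtered_eqI[where c = "k + l" and N = "\<lambda>F. E (F \<star> G) H" and M = "\<lambda>F. E F (E G H)"])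
    show "filtered (\<lambda>F. E (F \<star> G) H) (k + l)"
      unfolding filtered_def by (intro allI impI) (simp add: add.assoc[symmetric] E_vb star_vb kl)
    show "filtered (\<lambda>F. E F (E G H)) (k + l)"
      unfolding filtered_def by (intro allI impI) (simp add: E_vb kl)
    show "E (fls_monom f i \<star> G) H = E (fls_monom f i) (E G H)" for f i
      by (simp add: star_monom E_monom E_const E_L_power)
  qed (simp_all add: E_add star_add)
  then show ?thesis by (simp add: E_def)
qed

lemma star_add_left: "(F + G) \<star> H = F \<star> H + G \<star> H"
  unfolding pdo_mult_eq by (rule laurent_eval_add_left[OF refl L_degree_one])

lemma star_add_right: "F \<star> (G + H) = F \<star> G + F \<star> H"
  unfolding pdo_mult_eq by (rule laurent_eval_add_right[OF refl L_degree_one])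

lemma star_vanishes_below:
  "vanishes_below m F \<Longrightarrow> vanishes_below k G \<Longrightarrow> vanishes_below (m + k) (F \<star> G)"
  unfolding pdo_mult_eq by (rule laurent_eval_vanishes_below[OF refl L_degree_one])

lemma star_monom_left: "fls_monom f i \<star> G = fls_const f * int_funpow L i G"
  unfolding pdo_mult_eq by (rule laurent_eval_monom[OF refl L_degree_one])

lemma star_nth:
  assumes "vanishes_below m F" "vanishes_below k G"
  shows "(F \<star> G) $$ n = (\<Sum>i = m..n - k. F $$ i * int_funpow L i G $$ n)"
  unfolding pdo_mult_eq by (rule laurent_eval_nth[OF refl L_degree_one assms])

text \<open>
  For \<open>Y = L\<close> the operators \<open>N G\<close> commute with right multiplication by \<open>y\<close>, a shift, which agrees
  with \<open>L\<close> to leading order.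
\<close>

lemma L_star: "L G \<star> H = L (G \<star> H)"
  unfolding pdo_mult_eq
proof (rule laurent_eval_L[where T' = t_times])
  fix G H :: "'a fls" and n k :: int
  define E where "E = laurent_eval (\<lambda>f. f) L"
  define Z where "Z H = L (E G H) - E (L G) H" for H
  assume "\<And>k H. vanishes_below k H \<Longrightarrow> vanishes_below (k + n) (L (laurent_eval (\<lambda>f. f) L G H) -
      laurent_eval (\<lambda>f. f) L (L G) H)"
  then have Z: "vanishes_below (k + n) (Z H)" if "vanishes_below k H" for k H
    using that by (simp add: Z_def E_def)
  assume H: "vanishes_below k H"
  have E_shift: "E F (fls_shift j H) = fls_shift j (E F H)" for F H j
  proof -
    obtain l where l: "vanishes_below l H" using vanishes_below_subdegree by blast
    have pow: "int_funpow L i (fls_shift j H) = fls_shift j (int_funpow L i H)" for i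
    proof (induction i rule: int_funpow_induct)
      case (down i)
      have "L (fls_shift j (inv_into UNIV L (int_funpow L i H))) = fls_shift j (int_funpow L i H)"
        by (simp add: L_shift bij_apply_inv_into[OF bij_L])
      then have "inv_into UNIV L (L (fls_shift j (inv_into UNIV L (int_funpow L i H)))) =
          inv_into UNIV L (int_funpow L i (fls_shift j H))"
        by (simp only: down)
      then show ?case
        by (simp only: int_funpow_minus_1[OF bij_L] bij_inv_into_apply[OF bij_L])
    qed (simp_all add: int_funpow_plus_1[OF bij_L] L_shift)
    show ?thesis
    proof (rule additive_filtered_eqI[where c = "l - j" and N = "\<lambda>F. E F (fls_shift j H)"
          and M = "\<lambda>F. fls_shift j (E F H)"])
      show "filtered (\<lambda>F. E F (fls_shift j H)) (l - j)"
        unfolding E_def by (rule laurent_eval_filtered[OF refl L_degree_one])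
          (simp add: vanishes_below_shift l)
      show "filtered (\<lambda>F. fls_shift j (E F H)) (l - j)"
        unfolding filtered_def E_def
        by (simp add: vanishes_below_shift laurent_eval_vanishes_below[OF refl L_degree_one _ l])
      show "E (fls_monom f i) (fls_shift j H) = fls_shift j (E (fls_monom f i) H)" for f i
        unfolding E_def laurent_eval_monom[OF refl L_degree_one] pow
        by (simp add: fls_shifted_times_simps)
    qed (simp_all add: E_def laurent_eval_add_left[OF refl L_degree_one])
  qed
  have Z_diff: "Z (A - B) = Z A - Z B" for A B
    by (rule additive_diff) (simp add: Z_def E_def L_add laurent_eval_add_right[OF refl L_degree_one])
  have "L (Z H) - Z (L H) = (L (Z H) - fls_shift (- 1) (Z H)) - Z (L H - fls_shift (- 1) H)"
    by (simp add: Z_diff) (simp add: Z_def E_shift L_shift)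
  moreover have "vanishes_below (k + n + 2) (L (Z H) - fls_shift (- 1) (Z H))"
    by (rule L_minus_shift_vanishes_below[OF Z[OF H]])
  moreover have "vanishes_below (k + n + 2) (Z (L H - fls_shift (- 1) H))"
    using Z[OF L_minus_shift_vanishes_below[OF H]] by (simp add: algebra_simps)
  ultimately have "vanishes_below (k + n + 2) (L (Z H) - Z (L H))"
    by (simp only: vanishes_below_diff)
  then show "vanishes_below (k + n + 2) (L (L (laurent_eval (\<lambda>f. f) L G H) -
      laurent_eval (\<lambda>f. f) L (L G) H) - (L (laurent_eval (\<lambda>f. f) L G (L H)) -
      laurent_eval (\<lambda>f. f) L (L G) (L H)))"
    by (simp add: Z_def E_def)
qed (simp_all add: L_degree_one t_times_L_L L_L_t_times t_times_const_mult)

lemma star_assoc: "(F \<star> G) \<star> H = F \<star> (G \<star> H)"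
  using laurent_eval_mult[OF refl refl L_degree_one L_star[unfolded pdo_mult_eq], of F G H]
  by (simp only: pdo_mult_eq)

lemma star_const_left: "fls_const f \<star> G = fls_const f * G"
  using star_monom_left[of f 0 G] by (simp add: fls_monom_degree_0)

lemma one_star [simp]: "1 \<star> G = G"
  using star_const_left[of 1 G] by simp

lemma zero_star [simp]: "0 \<star> G = 0"
  using star_const_left[of 0 G] by simp

lemma star_zero [simp]: "F \<star> 0 = 0"
  by (rule additive_0) (rule star_add_right)

lemma star_diff_left: "(F - G) \<star> H = F \<star> H - G \<star> H"
  by (rule additive_diff[of "\<lambda>F. F \<star> H"]) (rule star_add_left)

lemma star_diff_right: "F \<star> (G - H) = F \<star> G - F \<star> H"
  by (rule additive_diff) (rule star_add_right)

lemma filtered_star_left: "vanishes_below k H \<Longrightarrow> filtered (\<lambda>F. F \<star> H) k"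
  by (simp add: filtered_def star_vanishes_below)

lemma const_star_const: "fls_const f \<star> fls_const g = fls_const (f * g)"
  by (simp add: star_const_left)

lemma star_monom_right: "F \<star> fls_monom 1 j = fls_shift (- j) F"
proof (rule additive_filtered_eqI[where c = j and N = "\<lambda>F. F \<star> fls_monom 1 j" and
      M = "\<lambda>F. fls_shift (- j) F"])
  show "filtered (\<lambda>F. F \<star> fls_monom 1 j) j"
    by (rule filtered_star_left) simp
  show "filtered (fls_shift (- j)) j"
    by (simp add: filtered_def vanishes_below_shift)
  show "fls_monom f i \<star> fls_monom 1 j = fls_shift (- j) (fls_monom f i)" for f i
    by (simp add: star_monom_left L_power_monom_1)
qed (simp_all add: star_add_left)

lemma star_one [simp]: "F \<star> 1 = F"
  using star_monom_right[of F 0] by (simp add: fls_monom_degree_0)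

lemma monom_1_star_monom_1: "fls_monom 1 i \<star> fls_monom 1 j = fls_monom 1 (i + j)"
  by (simp add: star_monom_right)

lemma monom_eq_star: "fls_monom f i = fls_const f \<star> fls_monom 1 i"
  by (simp add: star_const_left)

lemma x_inverse_star: "fls_monom 1 (- 2) \<star> G = t_times G"
proof -
  have "int_funpow L 0 G = L (L (int_funpow L (- 2) G))"
    using int_funpow_plus_1[OF bij_L, of "- 2" G] int_funpow_plus_1[OF bij_L, of "- 1" G] by simp
  then have "t_times G = int_funpow L (- 2) G" using t_times_L_L[of "int_funpow L (- 2) G"] by (simp only: int_funpow_0)
  then show ?thesis by (simp add: star_monom_left)
qed

lemma star_leading:
  assumes "vanishes_below m F" "vanishes_below k G"
  shows "(F \<star> G) $$ (m + k) = F $$ m * G $$ k"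
  using L_power_leading[OF assms(2), of m] by (simp add: star_nth[OF assms] add.commute)

lemma star_subdegree:
  assumes "F \<noteq> 0" "G \<noteq> 0"
  shows "F \<star> G \<noteq> 0" "fls_subdegree (F \<star> G) = fls_subdegree F + fls_subdegree G"
proof -
  define m k where "m = fls_subdegree F" and "k = fls_subdegree G"
  have vb: "vanishes_below m F" "vanishes_below k G"
    by (simp_all add: m_def k_def vanishes_below_subdegree)
  have nz: "(F \<star> G) $$ (m + k) \<noteq> 0"
    using assms unfolding star_leading[OF vb] by (simp add: m_def k_def)
  then show "F \<star> G \<noteq> 0" by auto
  show "fls_subdegree (F \<star> G) = fls_subdegree F + fls_subdegree G"
    using nz star_vanishes_below[OF vb]
    by (intro fls_subdegree_eqI) (auto simp: m_def k_def vanishes_below_def)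
qed

lemma star_right_cancel:
  assumes "F \<star> H = G \<star> H" "H \<noteq> 0"
  shows "F = G"
  using star_subdegree(1)[of "F - G" H] assms by (auto simp: star_diff_left)

lemma star_commutator_vanishes_below:
  assumes "vanishes_below m F" "vanishes_below k G"
  shows "vanishes_below (m + k + 1) (F \<star> G - G \<star> F)"
proof (rule vanishes_below_Suc)
  show "vanishes_below (m + k) (F \<star> G - G \<star> F)"
    using star_vanishes_below[OF assms] star_vanishes_below[OF assms(2,1)]
    by (simp add: vanishes_below_diff add.commute)
  show "(F \<star> G - G \<star> F) $$ (m + k) = 0"
    using star_leading[OF assms] star_leading[OF assms(2,1)] by (simp add: mult.commute add.commute)
qed

section \<open>Square roots\<close>

text \<open>For \<open>V\<^sup>2 = W\<^sup>2\<close> the difference \<open>D = V - W\<close> satisfies \<open>V D + D W = 0\<close>, with leading term \<open>2 r D\<close>.\<close>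

lemma square_root_unique:
  assumes "vanishes_below m V" "vanishes_below m W" "V $$ m = W $$ m" "W $$ m \<noteq> 0"
    and eq: "V \<star> V = W \<star> W"
  shows "V = W"
proof (rule ccontr)
  assume "V \<noteq> W"
  define D where "D = V - W"
  define k where "k = fls_subdegree D"
  have D: "D \<noteq> 0" "vanishes_below k D" "D $$ k \<noteq> 0"
    using \<open>V \<noteq> W\<close> unfolding k_def nth_fls_subdegree_zero_iff
    by (simp_all add: D_def vanishes_below_subdegree)
  have "V \<star> D + D \<star> W = 0"
    by (simp add: D_def star_diff_left star_diff_right eq)
  moreover have "(V \<star> D + D \<star> W) $$ (m + k) = 2 * W $$ m * D $$ k"
    using star_leading[OF assms(1) D(2)] star_leading[OF D(2) assms(2)] assms(3)
    by (simp add: add.commute mult.commute)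
  ultimately show False using assms(4) D(3) by simp
qed

text \<open>
  The square root is built coefficient by coefficient: if \<open>W\<^sup>2\<close> is correct below degree \<open>2 m + n\<close>,
  then adding \<open>c y\<^bsup>m+n\<^esup>\<close> to \<open>W\<close> changes the next coefficient of \<open>W\<^sup>2\<close> by \<open>2 r c\<close>.
\<close>

lemma square_root_exists:
  assumes Z: "vanishes_below (2 * m) Z" "Z $$ (2 * m) = r\<^sup>2" and r: "r * r' = 1"
  obtains W where "vanishes_below m W" "W $$ m = r" "W \<star> W = Z"
proof -
  define c where "c n W = \<iota> (1 / 2) * r' * (Z - W \<star> W) $$ (2 * m + int n)" for n W
  define S where "S = rec_nat (fls_monom r m) (\<lambda>n W. W + fls_monom (c (Suc n) W) (m + int (Suc n)))"
  have S_0: "S 0 = fls_monom r m"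
    and S_Suc: "S (Suc n) = S n + fls_monom (c (Suc n) (S n)) (m + int (Suc n))" for n
    by (simp_all add: S_def)
  have S: "vanishes_below m (S n)" "S n $$ m = r" for n
    by (induction n) (simp_all add: S_0 S_Suc vanishes_below_add)
  have square: "vanishes_below (2 * m + int (Suc n)) (Z - S n \<star> S n)" for n
  proof (induction n)
    case 0
    have "vanishes_below (2 * m) (Z - S 0 \<star> S 0)"
      using Z(1) star_vanishes_below[OF S(1) S(1), of 0 0] by (simp add: vanishes_below_diff)
    then show ?case
      using vanishes_below_Suc[of "2 * m" "Z - S 0 \<star> S 0"] star_leading[OF S(1) S(1), of 0 0] Z(2)
      by (simp add: S power2_eq_square)
  next
    case (Suc n)
    define k where "k = m + int (Suc n)"
    define M where "M = fls_monom (c (Suc n) (S n)) k"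
    have M: "vanishes_below k M" "M $$ k = c (Suc n) (S n)" by (simp_all add: M_def)
    have km: "m + k = 2 * m + int (Suc n)" "k + m = 2 * m + int (Suc n)" by (simp_all add: k_def)
    have eq: "Z - S (Suc n) \<star> S (Suc n) = (Z - S n \<star> S n) - (S n \<star> M + M \<star> S n + M \<star> M)"
      by (simp add: S_Suc M_def k_def star_add_left star_add_right)
    have MM: "vanishes_below (2 * m + int (Suc n) + 1) (M \<star> M)"
      by (rule vanishes_below_mono[OF star_vanishes_below[OF M(1) M(1)]]) (simp add: k_def)
    have "vanishes_below (2 * m + int (Suc n)) (Z - S (Suc n) \<star> S (Suc n))"
      unfolding eq
      using Suc star_vanishes_below[OF S(1) M(1), of n] star_vanishes_below[OF M(1) S(1), of n]
        vanishes_below_mono[OF MM, of "2 * m + int (Suc n)"]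
      unfolding km by (simp add: vanishes_below_diff vanishes_below_add)
    moreover have "(Z - S (Suc n) \<star> S (Suc n)) $$ (2 * m + int (Suc n)) = 0"
    proof -
      have "2 * (r * c (Suc n) (S n)) = (r * r') * (2 * (\<iota> (1 / 2) *
          (Z - S n \<star> S n) $$ (2 * m + int (Suc n))))"
        unfolding c_def by (simp only: mult_ac)
      then have "2 * (r * c (Suc n) (S n)) = (Z - S n \<star> S n) $$ (2 * m + int (Suc n))"
        by (simp only: r half_cancel mult_1)
      moreover have "(S n \<star> M + M \<star> S n + M \<star> M) $$ (2 * m + int (Suc n)) =
          2 * (r * c (Suc n) (S n))"
        using star_leading[OF S(1) M(1), of n] star_leading[OF M(1) S(1), of n]
          vanishes_belowD[OF MM, of "2 * m + int (Suc n)"]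
        unfolding km M(2) S(2) by (simp add: mult.commute)
      ultimately show ?thesis
        unfolding eq fls_minus_nth by simp
    qed
    ultimately have "vanishes_below (2 * m + int (Suc n) + 1) (Z - S (Suc n) \<star> S (Suc n))"
      by (rule vanishes_below_Suc)
    then show ?case by (simp add: algebra_simps)
  qed
  have stable: "S (n + l) $$ i = S n $$ i" if "i \<le> m + int n" for n l i
    by (induction l) (use that in \<open>simp_all add: S_Suc\<close>)
  define W where "W = Abs_fls (\<lambda>i. S (nat (i - m)) $$ i)"
  have W_nth: "W $$ i = S (nat (i - m)) $$ i" for i
    unfolding W_def
    by (rule nth_Abs_fls_lower_bound[of m]) (use S(1) in \<open>auto simp: vanishes_below_def\<close>)
  have W: "vanishes_below m W" "W $$ m = r"
    using S by (auto simp: vanishes_below_def W_nth)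
  have W_S: "vanishes_below (m + int (Suc n)) (W - S n)" for n
  proof (rule vanishes_belowI)
    fix i assume i: "i < m + int (Suc n)"
    show "(W - S n) $$ i = 0"
    proof (cases "i < m")
      case True
      then show ?thesis using W(1) S(1) by (simp add: vanishes_below_def)
    next
      case False
      with i have "nat (i - m) \<le> n" "i \<le> m + int (nat (i - m))" by auto
      with stable[of i "nat (i - m)" "n - nat (i - m)"] show ?thesis by (simp add: W_nth)
    qed
  qed
  have "vanishes_below (2 * m + int n) (Z - W \<star> W)" for n
  proof -
    have "Z - W \<star> W = (Z - S n \<star> S n) - (W \<star> (W - S n) + (W - S n) \<star> S n)"
      by (simp add: star_diff_left star_diff_right)
    moreover have "vanishes_below (2 * m + int n) (Z - S n \<star> S n)"
      by (rule vanishes_below_mono[OF square]) simp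
    moreover have "vanishes_below (2 * m + int n) (W \<star> (W - S n))"
      by (rule vanishes_below_mono[OF star_vanishes_below[OF W(1) W_S]]) simp
    moreover have "vanishes_below (2 * m + int n) ((W - S n) \<star> S n)"
      by (rule vanishes_below_mono[OF star_vanishes_below[OF W_S S(1)]]) simp
    ultimately show ?thesis by (simp only: vanishes_below_diff vanishes_below_add)
  qed
  then have "Z - W \<star> W = 0" by (rule vanishes_below_all_eq_0)
  then show ?thesis using that[OF W] by simp
qed

section \<open>Extending automorphisms\<close>

definition pdo_hom :: "('a fls \<Rightarrow> 'a fls) \<Rightarrow> bool"
  where "pdo_hom \<Theta> \<longleftrightarrow> (\<forall>F G. \<Theta> (F + G) = \<Theta> F + \<Theta> G) \<and> (\<forall>F G. \<Theta> (F \<star> G) = \<Theta> F \<star> \<Theta> G)"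

lemma pdo_homD:
  assumes "pdo_hom \<Theta>"
  shows "\<Theta> (F + G) = \<Theta> F + \<Theta> G" "\<Theta> (F \<star> G) = \<Theta> F \<star> \<Theta> G" "\<Theta> (F - G) = \<Theta> F - \<Theta> G"
    "\<Theta> 0 = 0"
proof -
  show add: "\<Theta> (F + G) = \<Theta> F + \<Theta> G" for F G
    using assms by (simp add: pdo_hom_def)
  show "\<Theta> (F \<star> G) = \<Theta> F \<star> \<Theta> G"
    using assms by (simp add: pdo_hom_def)
  show "\<Theta> (F - G) = \<Theta> F - \<Theta> G" "\<Theta> 0 = 0"
    using additive_diff[of \<Theta>, OF add] additive_0[of \<Theta>, OF add] by auto
qed

text \<open>
  The extension of \<open>\<alpha>\<close> determined by a unit \<open>s\<close>: \<open>y\<inverse>\<close> goes to the square root of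
  \<open>s x\<inverse> s\<close> with leading term \<open>s y\<inverse>\<close>.  This shape, unlike \<open>s\<^sup>2 x\<inverse>\<close>, is preserved by composition.
\<close>

definition extension_with :: "('a \<Rightarrow> 'a) \<Rightarrow> 'a \<Rightarrow> ('a fls \<Rightarrow> 'a fls) \<Rightarrow> bool"
  where "extension_with \<alpha> s \<Theta> \<longleftrightarrow> pdo_hom \<Theta> \<and> filtered \<Theta> 0 \<and>
    (\<forall>f. \<Theta> (fls_const f) = fls_const (\<alpha> f)) \<and>
    \<Theta> (fls_monom 1 (- 1)) $$ (- 1) = s \<and>
    \<Theta> (fls_monom 1 (- 2)) = fls_const s \<star> fls_monom 1 (- 2) \<star> fls_const s"

lemma extension_withD:
  assumes "extension_with \<alpha> s \<Theta>"
  shows "pdo_hom \<Theta>" "filtered \<Theta> 0" "\<Theta> (fls_const f) = fls_const (\<alpha> f)"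
    "\<Theta> (fls_monom 1 (- 1)) $$ (- 1) = s"
    "\<Theta> (fls_monom 1 (- 2)) = fls_const s \<star> fls_monom 1 (- 2) \<star> fls_const s"
    "vanishes_below (- 1) (\<Theta> (fls_monom 1 (- 1)))"
proof -
  show "pdo_hom \<Theta>" "\<Theta> (fls_const f) = fls_const (\<alpha> f)" "\<Theta> (fls_monom 1 (- 1)) $$ (- 1) = s"
    "\<Theta> (fls_monom 1 (- 2)) = fls_const s \<star> fls_monom 1 (- 2) \<star> fls_const s"
    and filt: "filtered \<Theta> 0"
    using assms unfolding extension_with_def by blast+
  show "vanishes_below (- 1) (\<Theta> (fls_monom 1 (- 1)))"
    using filteredD[OF filt vanishes_below_monom[OF order_refl], of "- 1" 1] by simp
qed

text \<open>
  Both images of \<open>y\<inverse>\<close> square to the image of \<open>x\<inverse>\<close>, with the same leading term, and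
  filtered homomorphisms are determined by their values on \<open>R\<close> and \<open>y\<inverse>\<close>.
\<close>

lemma extension_with_unique:
  assumes "extension_with \<alpha> s \<Theta>" "extension_with \<alpha> s \<Theta>'" "s \<noteq> 0"
  shows "\<Theta> F = \<Theta>' F"
proof -
  note \<Theta> = extension_withD[OF assms(1)] and \<Theta>' = extension_withD[OF assms(2)]
  let ?y' = "fls_monom 1 (- 1) :: 'a fls"
  have y'_y': "?y' \<star> ?y' = fls_monom 1 (- 2)"
    by (simp add: monom_1_star_monom_1)
  have "\<Theta> ?y' \<star> \<Theta> ?y' = \<Theta>' ?y' \<star> \<Theta>' ?y'"
    unfolding pdo_homD(2)[OF \<Theta>(1), symmetric] pdo_homD(2)[OF \<Theta>'(1), symmetric] y'_y'
    by (simp only: \<Theta>(5) \<Theta>'(5))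
  then have y': "\<Theta> ?y' = \<Theta>' ?y'"
    by (rule square_root_unique[of "- 1", rotated 4]) (simp_all add: \<Theta> \<Theta>' assms(3))
  have nz: "\<Theta>' ?y' \<noteq> 0"
    using \<Theta>'(4) assms(3) by auto
  have step: "\<Theta> (fls_monom 1 (i - 1)) = \<Theta> (fls_monom 1 i) \<star> \<Theta> ?y'"
    "\<Theta>' (fls_monom 1 (i - 1)) = \<Theta>' (fls_monom 1 i) \<star> \<Theta>' ?y'" for i
    unfolding pdo_homD(2)[OF \<Theta>(1), symmetric] pdo_homD(2)[OF \<Theta>'(1), symmetric]
    by (simp_all add: monom_1_star_monom_1)
  have powers: "\<Theta> (fls_monom 1 i) = \<Theta>' (fls_monom 1 i)" for i
  proof (induction i rule: int_funpow_induct)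
    case zero
    show ?case using \<Theta>(3)[of 1] \<Theta>'(3)[of 1] by (simp add: fls_monom_degree_0)
  next
    case (up i)
    then show ?case
      using step[of "i + 1"] by (intro star_right_cancel[OF _ nz, of "\<Theta> (fls_monom 1 (i + 1))"]) (simp add: y')
  next
    case (down i)
    then show ?case by (simp add: step y')
  qed
  show ?thesis
  proof (rule additive_filtered_eqI[of \<Theta> \<Theta>' 0])
    show "\<Theta> (fls_monom f i) = \<Theta>' (fls_monom f i)" for f i
      unfolding monom_eq_star[of f i] pdo_homD(2)[OF \<Theta>(1)] pdo_homD(2)[OF \<Theta>'(1)] \<Theta>(3) \<Theta>'(3) powers
      by (rule refl)
  qed (simp_all add: pdo_homD[OF \<Theta>(1)] pdo_homD[OF \<Theta>'(1)] \<Theta>(2) \<Theta>'(2))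
qed

text \<open>The source of the cocycle identity: apply it to the image \<open>W\<close> of \<open>y\<inverse>\<close> under another extension.\<close>

lemma leading_coeff_compose:
  assumes "pdo_hom \<Theta>" "filtered \<Theta> 0" "\<And>f. \<Theta> (fls_const f) = fls_const (\<beta> f)"
    and W: "vanishes_below (- 1) W"
  shows "\<Theta> W $$ (- 1) = \<beta> (W $$ (- 1)) * \<Theta> (fls_monom 1 (- 1)) $$ (- 1)"
proof -
  define W' where "W' = W - fls_monom (W $$ (- 1)) (- 1)"
  have "vanishes_below 0 W'"
    using vanishes_below_diff_lead[OF W] by (simp add: W'_def)
  then have "vanishes_below 0 (\<Theta> W')"
    using filteredD[OF assms(2), of 0 W'] by simp
  moreover have "\<Theta> W = \<Theta> W' + fls_const (\<beta> (W $$ (- 1))) \<star> \<Theta> (fls_monom 1 (- 1))"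
    unfolding W'_def pdo_homD(3)[OF assms(1)] assms(3)[symmetric] pdo_homD(2)[OF assms(1), symmetric]
      monom_eq_star[symmetric]
    by simp
  ultimately show ?thesis by (simp add: star_const_left vanishes_below_def)
qed

lemma extension_with_compose:
  assumes "extension_with \<alpha> s \<Theta>" "extension_with \<beta> r \<Theta>'"
  shows "extension_with (\<lambda>f. \<beta> (\<alpha> f)) (\<beta> s * r) (\<lambda>F. \<Theta>' (\<Theta> F))"
proof -
  note \<Theta> = extension_withD[OF assms(1)] and \<Theta>' = extension_withD[OF assms(2)]
  note hom = pdo_homD[OF \<Theta>(1)] and hom' = pdo_homD[OF \<Theta>'(1)]
  have "\<Theta>' (\<Theta> (fls_monom 1 (- 1))) $$ (- 1) = \<beta> s * r"
    using leading_coeff_compose[OF \<Theta>'(1-3) \<Theta>(6)] \<Theta>(4) \<Theta>'(4) by simp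
  moreover have "\<Theta>' (\<Theta> (fls_monom 1 (- 2))) =
      fls_const (\<beta> s * r) \<star> fls_monom 1 (- 2) \<star> fls_const (\<beta> s * r)"
  proof -
    have "\<Theta>' (\<Theta> (fls_monom 1 (- 2))) =
        fls_const (\<beta> s) \<star> (fls_const r \<star> fls_monom 1 (- 2) \<star> fls_const r) \<star> fls_const (\<beta> s)"
      by (simp only: \<Theta> \<Theta>' hom')
    also have "\<dots> = (fls_const (\<beta> s) \<star> fls_const r) \<star> fls_monom 1 (- 2) \<star>
        (fls_const r \<star> fls_const (\<beta> s))"
      by (simp only: star_assoc)
    finally show ?thesis by (simp only: const_star_const mult.commute[of r])
  qed
  ultimately show ?thesis
    using \<Theta>(2) \<Theta>'(2) by (auto simp: extension_with_def pdo_hom_def hom hom' \<Theta> \<Theta>' filtered_def)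
qed

lemma extension_with_id: "extension_with (\<lambda>f. f) 1 (\<lambda>F. F)"
  by (simp add: extension_with_def pdo_hom_def filtered_def)

text \<open>
  Let \<open>W\<^sup>2 = s x\<inverse> s\<close>.  Since \<open>s x\<inverse> s\<close> induces on \<open>R\<close> the derivation \<open>- s\<^sup>2 d\<close>, which
  \<open>\<alpha>\<close> intertwines with \<open>- d\<close>, evaluation at left multiplication by \<open>W\<inverse>\<close> is multiplicative.
\<close>

lemma extension_with_exists:
  assumes \<alpha>: "\<And>f g. \<alpha> (f + g) = \<alpha> f + \<alpha> g" "\<And>f g. \<alpha> (f * g) = \<alpha> f * \<alpha> g" "\<alpha> 1 = 1"
    and s: "s * s' = 1" and compat: "\<And>f. \<alpha> (d f) = s\<^sup>2 * d (\<alpha> f)"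
  shows "\<exists>\<Theta>. extension_with \<alpha> s \<Theta>"
proof -
  define Z where "Z = fls_const s \<star> fls_monom 1 (- 2) \<star> fls_const s"
  have Z_star: "Z \<star> H = fls_const s * t_times (fls_const s * H)" for H
    unfolding Z_def star_assoc by (simp only: star_const_left x_inverse_star)
  have "Z = fls_const s * t_times (fls_const s * fls_monom 1 0)"
    using Z_star[of 1] by (simp add: fls_monom_degree_0)
  then have "Z = fls_monom (s * s) (- 2) - fls_monom (s * d s) 0"
    by (simp only: fls_const_mult_monom t_times_monom right_diff_distrib) simp
  then have "vanishes_below (2 * - 1) Z" "Z $$ (2 * - 1) = s\<^sup>2"
    by (simp_all add: vanishes_below_diff power2_eq_square)
  then obtain W where W: "vanishes_below (- 1) W" "W $$ (- 1) = s" "W \<star> W = Z"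
    using square_root_exists[OF _ _ s] by blast
  define X where "X = fls_const s' \<star> fls_monom 1 2 \<star> fls_const s'"
  have X: "vanishes_below 2 X"
    using star_vanishes_below[OF star_vanishes_below[of 0 "fls_const s'" 2 "fls_monom 1 2"],
        of 0 "fls_const s'"]
    by (simp add: X_def vanishes_below_def)
  have ss': "fls_const s \<star> (fls_const s' \<star> H) = H" "fls_const s' \<star> (fls_const s \<star> H) = H" for H
    using s by (simp_all add: const_star_const mult.commute flip: star_assoc)
  have xx': "fls_monom 1 2 \<star> (fls_monom 1 (- 2) \<star> H) = H"
    "fls_monom 1 (- 2) \<star> (fls_monom 1 2 \<star> H) = H" for H
    by (simp_all add: monom_1_star_monom_1 fls_monom_degree_0 flip: star_assoc)
  have ss'_1: "fls_const s \<star> fls_const s' = 1" "fls_const s' \<star> fls_const s = 1"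
    using ss'[of 1] by simp_all
  have ZX: "Z \<star> X = 1" and XZ: "X \<star> Z = 1"
    by (simp_all add: Z_def X_def star_assoc ss' xx' ss'_1)
  have WX: "W \<star> X = X \<star> W"
  proof -
    have "X \<star> W = X \<star> W \<star> (Z \<star> X)" by (simp add: ZX)
    also have "\<dots> = (X \<star> Z) \<star> W \<star> X" by (simp add: star_assoc flip: W(3))
    finally show ?thesis by (simp add: XZ)
  qed
  define V where "V = X \<star> W"
  have VW: "V \<star> W = 1" by (simp add: V_def star_assoc W(3) XZ)
  have WV: "W \<star> V = 1" by (simp add: V_def W(3) ZX flip: WX star_assoc)
  have VW_H: "V \<star> (W \<star> H) = H" and WV_H: "W \<star> (V \<star> H) = H" for H
    by (simp_all add: VW WV flip: star_assoc)
  have V: "vanishes_below 1 V"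
    using star_vanishes_below[OF X W(1)] by (simp add: V_def)
  define Y where "Y = (\<lambda>H. V \<star> H)"
  have Y: "degree_one_operator Y"
    unfolding degree_one_operator_def
  proof (intro conjI allI)
    show "bij Y"
      by (rule o_bij[of "\<lambda>H. W \<star> H"]) (simp_all add: fun_eq_iff Y_def VW_H WV_H)
    show "Y (F + G) = Y F + Y G" for F G
      by (simp add: Y_def star_add_right)
    show "vanishes_below (m + 1) (Y H) \<longleftrightarrow> vanishes_below m H" for m H
      using star_vanishes_below[OF V, of m H] star_vanishes_below[OF W(1), of "m + 1" "V \<star> H"]
      by (auto simp: Y_def WV_H add.commute)
  qed
  have inv_Y: "inv_into UNIV Y H = W \<star> H" for H
    using bij_inv_into_apply[OF degree_one_operatorD(1)[OF Y], of "W \<star> H"] by (simp add: Y_def VW_H)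
  have Y_power: "int_funpow Y i H = int_funpow Y i 1 \<star> H" for i H
  proof (induction i rule: int_funpow_induct)
    case (up i)
    then show ?case
      unfolding int_funpow_plus_1[OF degree_one_operatorD(1)[OF Y]] by (simp add: Y_def star_assoc)
  next
    case (down i)
    then show ?case
      unfolding int_funpow_minus_1[OF degree_one_operatorD(1)[OF Y]] by (simp add: inv_Y star_assoc)
  qed simp
  define E where "E = laurent_eval \<alpha> Y"
  note E_add = laurent_eval_add_left[of \<alpha> Y, OF \<alpha>(1) Y, folded E_def]
  note E_vb = laurent_eval_vanishes_below[of \<alpha> Y, OF \<alpha>(1) Y, folded E_def]
  note E_monom = laurent_eval_monom[of \<alpha> Y, OF \<alpha>(1) Y, folded E_def]
  have vb_1: "vanishes_below 0 (1 :: 'a fls)" by (simp add: vanishes_below_def)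
  have E_star: "E G H = E G 1 \<star> H" for G H
  proof -
    obtain k where k: "vanishes_below k H" using vanishes_below_subdegree by blast
    show ?thesis
    proof (rule additive_filtered_eqI[where c = k and N = "\<lambda>G. E G H" and M = "\<lambda>G. E G 1 \<star> H"])
      show "filtered (\<lambda>G. E G 1 \<star> H) k"
        unfolding filtered_def using star_vanishes_below[OF E_vb[OF _ vb_1] k] by simp
      show "E (fls_monom f i) H = E (fls_monom f i) 1 \<star> H" for f i
        unfolding E_monom by (subst Y_power) (simp only: star_assoc flip: star_const_left)
    qed (simp_all add: E_add star_add_left filtered_def E_vb k)
  qed
  have E_L: "E (L G) H = Y (E G H)" for G H
    unfolding E_def
  proof (rule laurent_eval_L[OF \<alpha>(1) Y, where T' = "\<lambda>H. Z \<star> H"])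
    show "Z \<star> Y (Y H) = H" "Y (Y (Z \<star> H)) = H" for H
      by (simp_all add: Y_def star_assoc VW_H WV_H flip: W(3))
    show "Z \<star> (fls_const (\<alpha> g) * H) = fls_const (\<alpha> g) * (Z \<star> H) - fls_const (\<alpha> (d g)) * H" for g H
    proof -
      have eq: "fls_const s * (fls_const (\<alpha> g) * H) = fls_const (\<alpha> g) * (fls_const s * H)"
        by (rule mult.left_commute)
      moreover have "fls_const (\<alpha> (d g)) = fls_const s * fls_const (d (\<alpha> g)) * fls_const s"
        by (simp add: compat power2_eq_square mult_ac)
      ultimately show ?thesis
        unfolding Z_star eq t_times_const_mult by (simp only: algebra_simps)
    qed
    fix G H :: "'a fls" and n k :: int
    define z where "z = Y (E G 1) - E (L G) 1"
    have N: "Y (E G H) - E (L G) H = z \<star> H" for H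
      by (simp add: z_def Y_def E_star[of _ H] star_diff_left star_assoc)
    assume "\<And>k H. vanishes_below k H \<Longrightarrow>
      vanishes_below (k + n) (Y (laurent_eval \<alpha> Y G H) - laurent_eval \<alpha> Y (L G) H)"
    from this[OF vb_1] have z: "vanishes_below n z" by (simp add: z_def E_def)
    assume H: "vanishes_below k H"
    have "Y (z \<star> H) - z \<star> Y H = (V \<star> z - z \<star> V) \<star> H"
      by (simp add: Y_def star_diff_left star_assoc)
    moreover have "vanishes_below (k + n + 2) ((V \<star> z - z \<star> V) \<star> H)"
      using star_vanishes_below[OF star_commutator_vanishes_below[OF V z] H]
      by (simp add: algebra_simps)
    ultimately show "vanishes_below (k + n + 2)
        (Y (Y (laurent_eval \<alpha> Y G H) - laurent_eval \<alpha> Y (L G) H) -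
          (Y (laurent_eval \<alpha> Y G (Y H)) - laurent_eval \<alpha> Y (L G) (Y H)))"
      unfolding E_def[symmetric] N by simp
  qed
  define \<Theta> where "\<Theta> F = E F 1" for F
  have hom: "pdo_hom \<Theta>"
    using laurent_eval_mult[OF \<alpha>(1,2) Y E_L[unfolded E_def], folded E_def, of _ _ 1]
    by (simp add: pdo_hom_def \<Theta>_def E_add) (use E_star in metis)
  have "filtered \<Theta> 0"
    using E_vb[OF _ vb_1] by (simp add: filtered_def \<Theta>_def)
  moreover have "\<Theta> (fls_const f) = fls_const (\<alpha> f)" for f
    using E_monom[of f 0 1] by (simp add: \<Theta>_def fls_monom_degree_0)
  moreover have \<Theta>_y': "\<Theta> (fls_monom 1 (- 1)) = W"
    using E_monom[of 1 "- 1" 1] int_funpow_minus_1[OF degree_one_operatorD(1)[OF Y], of 0 1]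
    by (simp add: \<Theta>_def \<alpha>(3) inv_Y)
  moreover have "\<Theta> (fls_monom 1 (- 2)) = Z"
    using pdo_homD(2)[OF hom, of "fls_monom 1 (- 1)" "fls_monom 1 (- 1)"]
    by (simp add: monom_1_star_monom_1 \<Theta>_y' W(3))
  ultimately have "extension_with \<alpha> s \<Theta>"
    by (simp add: extension_with_def hom W(2) Z_def)
  then show ?thesis by blast
qed

section \<open>The parity automorphism\<close>

definition parity :: "'a fls \<Rightarrow> 'a fls"
  where "parity F = Abs_fls (\<lambda>n. if even n then F $$ n else - F $$ n)"

lemma parity_nth: "parity F $$ n = (if even n then F $$ n else - F $$ n)"
  unfolding parity_def by (rule nth_Abs_fls_lower_bound[of "fls_subdegree F"]) simp

lemma parity_add: "parity (F + G) = parity F + parity G"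
  by (rule fls_eqI) (simp add: parity_nth)

lemma filtered_parity: "filtered parity 0"
  by (simp add: filtered_def vanishes_below_def parity_nth)

lemma parity_monom: "parity (fls_monom f i) = fls_monom (if even i then f else - f) i"
  by (rule fls_eqI) (simp add: parity_nth)

lemma parity_const: "parity (fls_const f) = fls_const f"
  by (rule fls_eqI) (simp add: parity_nth)

lemma parity_1: "parity 1 = 1"
  using parity_const[of 1] by simp

text \<open>
  Parity is multiplicative because it is the extension of the identity belonging to the
  nontrivial choice \<open>s = -1\<close> of a square root of \<open>1\<close>.
\<close>

lemma parity_hom: "pdo_hom parity"
proof -
  obtain \<Theta> where \<Theta>_ext: "extension_with (\<lambda>f. f) (- 1) \<Theta>"
    using extension_with_exists[of "\<lambda>f. f" "- 1" "- 1"] by auto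
  note \<Theta> = extension_withD[OF \<Theta>_ext] and hom = pdo_homD[OF extension_withD(1)[OF \<Theta>_ext]]
  let ?y' = "fls_monom 1 (- 1) :: 'a fls"
  have minus_star: "(- F) \<star> G = - (F \<star> G)" and star_minus: "F \<star> (- G) = - (F \<star> G)" for F G
    using star_diff_left[of 0 F G] star_diff_right[of F 0 G] by simp_all
  have t: "fls_const (- 1) \<star> fls_monom 1 (- 2) \<star> fls_const (- 1) = fls_monom 1 (- 2)"
    by (simp add: minus_star star_minus)
  have y'_y': "?y' \<star> ?y' = fls_monom 1 (- 2)"
    by (simp add: monom_1_star_monom_1)
  have "\<Theta> ?y' \<star> \<Theta> ?y' = (- ?y') \<star> (- ?y')"
    unfolding hom(2)[symmetric] y'_y' \<Theta>(5) t minus_star star_minus by simp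
  then have y': "\<Theta> ?y' = - ?y'"
    by (rule square_root_unique[of "- 1", rotated 4])
      (simp_all add: \<Theta>(4,6), simp add: vanishes_below_def)
  have step: "\<Theta> (fls_monom 1 (i - 1)) = \<Theta> (fls_monom 1 i) \<star> \<Theta> ?y'" for i
    unfolding hom(2)[symmetric] by (simp add: monom_1_star_monom_1)
  have powers: "\<Theta> (fls_monom 1 i) = parity (fls_monom 1 i)" for i
  proof (induction i rule: int_funpow_induct)
    case zero
    show ?case using \<Theta>(3)[of 1] by (simp add: fls_monom_degree_0 parity_1)
  next
    case (up i)
    have "\<Theta> (fls_monom 1 (i + 1)) \<star> \<Theta> ?y' = parity (fls_monom 1 i)"
      using step[of "i + 1"] up by simp
    also have "\<dots> = parity (fls_monom 1 (i + 1)) \<star> \<Theta> ?y'"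
      by (simp add: y' star_minus star_monom_right parity_monom fls_eq_iff)
    finally have "\<Theta> (fls_monom 1 (i + 1)) \<star> \<Theta> ?y' = parity (fls_monom 1 (i + 1)) \<star> \<Theta> ?y'" .
    then show ?case by (rule star_right_cancel) (auto simp: y' fls_eq_iff)
  next
    case (down i)
    then show ?case by (simp add: step y' star_minus star_monom_right parity_monom fls_eq_iff)
  qed
  have "\<Theta> F = parity F" for F
  proof (rule additive_filtered_eqI[of \<Theta> parity 0])
    show "\<Theta> (fls_monom f i) = parity (fls_monom f i)" for f i
      unfolding monom_eq_star[of f i] hom(2) \<Theta>(3) powers
      by (simp add: parity_monom star_const_left)
  qed (simp_all add: hom(1) \<Theta>(2) parity_add filtered_parity)
  then have "\<Theta> = parity" by (rule ext)
  then show ?thesis using \<Theta>(1) by simp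
qed

lemma pdo_even_iff_odd_coeffs: "F \<in> pdo_even \<longleftrightarrow> (\<forall>n. odd n \<longrightarrow> F $$ n = 0)"
proof
  assume "F \<in> pdo_even"
  then show "\<forall>n. odd n \<longrightarrow> F $$ n = 0"
    by (auto simp: pdo_even_def fls_nth_compose_power)
next
  assume F: "\<forall>n. odd n \<longrightarrow> F $$ n = 0"
  define G where "G = Abs_fls (\<lambda>n. F $$ (2 * n))"
  have "G $$ n = F $$ (2 * n)" for n
    unfolding G_def by (rule nth_Abs_fls_lower_bound[of "- \<bar>fls_subdegree F\<bar>"]) auto
  then have "F = fls_compose_power G 2"
    using F by (intro fls_eqI) (auto simp: fls_nth_compose_power elim: evenE)
  then show "F \<in> pdo_even" by (simp add: pdo_even_def)
qed

lemma pdo_even_iff_parity: "F \<in> pdo_even \<longleftrightarrow> parity F = F"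
  by (auto simp: pdo_even_iff_odd_coeffs fls_eq_iff parity_nth)

section \<open>Automorphisms that extend an automorphism of the coefficients\<close>

text \<open>The term of lowest degree comes from \<open>y\<^sup>m g = g y\<^sup>m + m \<delta>(g) y\<^bsup>m+2\<^esup> + \<dots>\<close>.\<close>

lemma commutator_const:
  assumes F: "vanishes_below m F"
  shows "vanishes_below (m + 2) (F \<star> fls_const g - fls_const g \<star> F)"
    and "(F \<star> fls_const g - fls_const g \<star> F) $$ (m + 2) = of_int m * F $$ m * \<delta> g"
proof -
  define C where "C = F \<star> fls_const g - fls_const g \<star> F"
  have g: "vanishes_below 0 (fls_const g)" by (simp add: vanishes_below_def)
  have pow: "int_funpow L i (fls_const g) $$ i = g" "int_funpow L i (fls_const g) $$ (i + 1) = 0"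
    "int_funpow L i (fls_const g) $$ (i + 2) = of_int i * \<delta> g" for i
    using L_power_leading[OF g, of i] by simp_all
  have sets: "{m..m - 0} = {m}" "{m..m + 1 - 0} = {m, m + 1}" "{m..m + 2 - 0} = {m, m + 1, m + 2}"
    by auto
  have C_nth: "C $$ n = (\<Sum>i = m..n - 0. F $$ i * int_funpow L i (fls_const g) $$ n) - g * F $$ n" for n
    by (simp add: C_def star_nth[OF F g] star_const_left)
  have "C $$ m = 0"
    unfolding C_nth sets by (simp add: pow mult.commute)
  moreover have C1: "C $$ (m + 1) = 0"
    unfolding C_nth sets using pow(1)[of "m + 1"] by (simp add: pow mult.commute)
  moreover have "vanishes_below m C"
    using star_vanishes_below[OF F g] star_vanishes_below[OF g F]
    by (simp add: C_def vanishes_below_diff)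
  ultimately have "vanishes_below (m + 1 + 1) C"
    by (intro vanishes_below_Suc) auto
  then show "vanishes_below (m + 2) (F \<star> fls_const g - fls_const g \<star> F)"
    by (simp add: C_def add.assoc)
  have "C $$ (m + 2) = of_int m * F $$ m * \<delta> g"
    unfolding C_nth sets using pow(1)[of "m + 2"] pow(2)[of "m + 1"] pow(3)[of m]
    by (simp add: algebra_simps)
  then show "(F \<star> fls_const g - fls_const g \<star> F) $$ (m + 2) = of_int m * F $$ m * \<delta> g"
    by (simp add: C_def)
qed

text \<open>
  Without its constant term, a series that commutes with \<open>R\<close> has no lowest term \<open>D\<^sub>m y\<^sup>m\<close>, since
  its commutators have lowest terms \<open>m D\<^sub>m \<delta>(g) y\<^bsup>m+2\<^esup>\<close>, where \<open>m\<close> is not \<open>0\<close>.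
\<close>

lemma centralizer_of_coefficients:
  assumes comm: "\<And>g. F \<star> fls_const g = fls_const g \<star> F" and f: "d f \<noteq> 0"
  shows "F = fls_const (F $$ 0)"
proof (rule ccontr)
  assume "F \<noteq> fls_const (F $$ 0)"
  define D where "D = F - fls_const (F $$ 0)"
  define m where "m = fls_subdegree D"
  have D: "D \<noteq> 0" "D $$ 0 = 0" "vanishes_below m D"
    using \<open>F \<noteq> _\<close> by (simp_all add: D_def m_def vanishes_below_subdegree)
  have "D $$ m \<noteq> 0"
    unfolding m_def using D(1) by simp
  then have "m \<noteq> 0" using D(2) by auto
  have "D \<star> fls_const f - fls_const f \<star> D = 0"
    by (simp add: D_def star_diff_left star_diff_right comm const_star_const mult.commute)
  then have "of_int m * D $$ m * \<delta> f = 0"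
    using commutator_const(2)[OF D(3), of f] by simp
  then have "\<delta> f = 0" using \<open>m \<noteq> 0\<close> \<open>D $$ m \<noteq> 0\<close> by simp
  then show False using two_\<delta>[of f] f by simp
qed

lemma x_inverse_commutator:
  "fls_monom a (- 2) \<star> fls_const g - fls_const g \<star> fls_monom a (- 2) = - fls_const (a * d g)"
proof -
  have "fls_monom a (- 2) \<star> fls_const g = fls_const a * t_times (fls_monom g 0)"
    unfolding monom_eq_star[of a] star_assoc x_inverse_star
    by (simp add: star_const_left fls_monom_degree_0)
  then have "fls_monom a (- 2) \<star> fls_const g = fls_monom (a * g) (- 2) - fls_const (a * d g)"
    by (simp only: t_times_monom right_diff_distrib fls_const_mult_monom) (simp add: fls_monom_degree_0)
  then show ?thesis by (simp add: star_const_left mult.commute)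
qed

end

text \<open>
  The assumptions are purely algebraic: that \<open>\<Theta>\<close> respects the degree filtration, hence also
  infinite sums, has to be derived.
\<close>

locale pdo_extension = quadratic_pdo +
  fixes \<alpha> :: "'a \<Rightarrow> 'a" and \<Theta> :: "'a fls \<Rightarrow> 'a fls"
  assumes hom: "pdo_hom \<Theta>" and inj: "inj \<Theta>"
    and \<Theta>_const: "\<Theta> (fls_const f) = fls_const (\<alpha> f)"
    and \<alpha>_surj: "surj \<alpha>" and \<alpha>_1: "\<alpha> 1 = 1"
    and d_nonzero: "\<exists>f. d f \<noteq> 0"
begin

lemmas \<Theta>_add = pdo_homD(1)[OF hom] and \<Theta>_star = pdo_homD(2)[OF hom]
  and \<Theta>_diff = pdo_homD(3)[OF hom] and \<Theta>_0 = pdo_homD(4)[OF hom]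

lemma \<Theta>_eq_0: "\<Theta> F = 0 \<longleftrightarrow> F = 0"
  using inj \<Theta>_0 by (metis injD)

lemma \<Theta>_1: "\<Theta> 1 = 1"
  using \<Theta>_const[of 1] by (simp add: \<alpha>_1)

lemma \<alpha>_eq_0: "\<alpha> f = 0 \<longleftrightarrow> f = 0"
  using \<Theta>_const[of f] \<Theta>_eq_0[of "fls_const f"] by simp

lemma \<Theta>_monom_diff: "\<Theta> (fls_monom 1 (i - j)) = \<Theta> (fls_monom 1 i) \<star> \<Theta> (fls_monom 1 (- j))"
  unfolding \<Theta>_star[symmetric] by (simp add: monom_1_star_monom_1)

text \<open>
  The image \<open>K\<close> of \<open>x\<inverse>\<close> induces on \<open>R\<close> the nonzero derivation \<open>- \<alpha> d \<alpha>\<inverse>\<close>.  Since commutation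
  with \<open>K\<^sub>m y\<^bsup>m\<^esup>\<close> raises degrees by \<open>m + 2\<close>, and does so nontrivially if \<open>m\<close> is not \<open>0\<close>,
  this forces \<open>m = - 2\<close>; after subtraction of its leading term \<open>K\<close> commutes with \<open>R\<close>.
\<close>

lemma \<Theta>_x_inverse:
  obtains a b where "\<Theta> (fls_monom 1 (- 2)) = fls_monom a (- 2) + fls_const b" "a \<noteq> 0"
    "\<And>f. \<alpha> (d f) = a * d (\<alpha> f)"
proof -
  define K where "K = \<Theta> (fls_monom 1 (- 2))"
  define m where "m = fls_subdegree K"
  have "K \<noteq> 0" by (simp add: K_def \<Theta>_eq_0)
  then have K: "vanishes_below m K" "K $$ m \<noteq> 0"
    by (simp_all add: m_def vanishes_below_subdegree)
  have "\<Theta> (fls_monom 1 (- 2) \<star> fls_const g - fls_const g \<star> fls_monom 1 (- 2)) =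
      \<Theta> (0 - fls_const (d g))" for g
    by (simp add: x_inverse_commutator)
  then have commutator: "K \<star> fls_const (\<alpha> g) - fls_const (\<alpha> g) \<star> K = - fls_const (\<alpha> (d g))" for g
    unfolding \<Theta>_diff \<Theta>_star \<Theta>_const \<Theta>_0 K_def by simp
  note vb = commutator_const(1)[OF K(1), of "\<alpha> g" for g, unfolded commutator]
  note coeff = commutator_const(2)[OF K(1), of "\<alpha> g" for g, unfolded commutator]
  obtain f where f: "d f \<noteq> 0" using d_nonzero by blast
  have "m = - 2"
  proof (rule ccontr)
    assume "m \<noteq> - 2"
    then have *: "of_int m * K $$ m * \<delta> (\<alpha> g) = 0" for g
      using coeff[of g] by simp
    show False
    proof (cases "m > - 2")
      case True
      then have "\<alpha> (d f) = 0"
        using vanishes_belowD[OF vb[of f], of 0] by simp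
      then show False using f by (simp add: \<alpha>_eq_0)
    next
      case False
      then have "\<delta> (\<alpha> g) = 0" for g using *[of g] K(2) by simp
      then have "\<delta> f = 0" using \<alpha>_surj by (metis surjD)
      then show False using two_\<delta>[of f] f by simp
    qed
  qed
  define a where "a = K $$ (- 2)"
  have \<alpha>_d: "\<alpha> (d g) = a * d (\<alpha> g)" for g
  proof -
    have "- \<alpha> (d g) = - (a * (2 * \<delta> (\<alpha> g)))"
      using coeff[of g] by (simp add: \<open>m = - 2\<close> a_def)
    then show ?thesis by simp
  qed
  define P where "P = K - fls_monom a (- 2)"
  have "P \<star> fls_const h = fls_const h \<star> P" for h
  proof -
    obtain g where g: "h = \<alpha> g" using \<alpha>_surj by (metis surjD)
    have "P \<star> fls_const h - fls_const h \<star> P = (K \<star> fls_const h - fls_const h \<star> K) -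
        (fls_monom a (- 2) \<star> fls_const h - fls_const h \<star> fls_monom a (- 2))"
      by (simp add: P_def star_diff_left star_diff_right)
    also have "\<dots> = 0"
      unfolding g commutator x_inverse_commutator \<alpha>_d by simp
    finally show ?thesis by simp
  qed
  from centralizer_of_coefficients[OF this f] have "K = fls_monom a (- 2) + fls_const (P $$ 0)"
    by (simp add: P_def algebra_simps)
  moreover have "a \<noteq> 0" using K(2) by (simp add: a_def \<open>m = - 2\<close>)
  ultimately show ?thesis using that \<alpha>_d by (simp add: K_def)
qed

text \<open>The value of the cocycle: the square root of the coefficient \<open>a\<close> above that \<open>\<Theta>\<close> selects.\<close>

definition multiplier :: 'a
  where "multiplier = \<Theta> (fls_monom 1 (- 1)) $$ (- 1)"

lemma \<Theta>_y_inverse_subdegree: "fls_subdegree (\<Theta> (fls_monom 1 (- 1))) = - 1"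
proof -
  define Q where "Q = \<Theta> (fls_monom 1 (- 1))"
  obtain a b where ab: "\<Theta> (fls_monom 1 (- 2)) = fls_monom a (- 2) + fls_const b" "a \<noteq> 0"
    by (rule \<Theta>_x_inverse)
  have "Q \<noteq> 0" by (simp add: Q_def \<Theta>_eq_0)
  have "Q \<star> Q = fls_monom a (- 2) + fls_const b"
    using \<Theta>_monom_diff[of "- 1" 1] ab(1) by (simp add: Q_def)
  moreover have "fls_subdegree (fls_monom a (- 2) + fls_const b) = - 2"
    by (rule fls_subdegree_eqI) (use ab(2) in auto)
  ultimately show ?thesis
    using star_subdegree(2)[OF \<open>Q \<noteq> 0\<close> \<open>Q \<noteq> 0\<close>] by (simp add: Q_def)
qed

lemma \<Theta>_power_subdegree: "fls_subdegree (\<Theta> (fls_monom 1 i)) = i"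
proof (induction i rule: int_funpow_induct)
  case zero
  show ?case using \<Theta>_1 by (simp add: fls_monom_degree_0)
next
  case (up i)
  have nz: "\<Theta> (fls_monom 1 k) \<noteq> 0" for k by (simp add: \<Theta>_eq_0)
  show ?case
    using star_subdegree(2)[OF nz[of "i + 1"] nz[of "- 1"]] \<Theta>_monom_diff[of "i + 1" 1] up
    by (simp add: \<Theta>_y_inverse_subdegree)
next
  case (down i)
  have nz: "\<Theta> (fls_monom 1 k) \<noteq> 0" for k by (simp add: \<Theta>_eq_0)
  show ?case
    using star_subdegree(2)[OF nz[of i] nz[of "- 1"]] \<Theta>_monom_diff[of i 1] down
    by (simp add: \<Theta>_y_inverse_subdegree)
qed

lemma multiplier_unit: "\<exists>s'. multiplier * s' = 1"
proof -
  let ?y = "fls_monom 1 1 :: 'a fls" and ?y' = "fls_monom 1 (- 1) :: 'a fls"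
  have "\<Theta> ?y' \<star> \<Theta> ?y = 1"
    unfolding \<Theta>_star[symmetric] by (simp add: monom_1_star_monom_1 fls_monom_degree_0 \<Theta>_1)
  then have "\<Theta> ?y' $$ (- 1) * \<Theta> ?y $$ 1 = 1"
    using star_leading[of "- 1" "\<Theta> ?y'" 1 "\<Theta> ?y"] vanishes_below_subdegree[of "\<Theta> ?y'"]
      vanishes_below_subdegree[of "\<Theta> ?y"]
    by (simp add: \<Theta>_power_subdegree)
  then show ?thesis by (auto simp: multiplier_def)
qed

lemma \<alpha>_d: "\<alpha> (d f) = multiplier\<^sup>2 * d (\<alpha> f)"
proof -
  obtain a b where ab: "\<Theta> (fls_monom 1 (- 2)) = fls_monom a (- 2) + fls_const b"
    "\<And>f. \<alpha> (d f) = a * d (\<alpha> f)"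
    by (rule \<Theta>_x_inverse) blast
  have Q: "vanishes_below (- 1) (\<Theta> (fls_monom 1 (- 1)))"
    using vanishes_below_subdegree[of "\<Theta> (fls_monom 1 (- 1))"] by (simp add: \<Theta>_power_subdegree)
  have "multiplier\<^sup>2 = \<Theta> (fls_monom 1 (- 2)) $$ (- 2)"
    using star_leading[OF Q Q] \<Theta>_monom_diff[of "- 1" 1] by (simp add: multiplier_def power2_eq_square)
  also have "\<dots> = a" by (simp add: ab(1))
  finally show ?thesis by (simp add: ab(2))
qed

text \<open>
  Series with constant term \<open>1\<close> have roots of order \<open>2\<^sup>k\<close> for all \<open>k\<close>, so the degrees of
  their images are divisible by all powers of \<open>2\<close>.
\<close>

lemma \<Theta>_one_unit_subdegree:
  assumes "vanishes_below 0 U" "U $$ 0 = 1"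
  shows "fls_subdegree (\<Theta> U) = 0"
proof -
  have dvd: "2 ^ k dvd fls_subdegree (\<Theta> U)" if "vanishes_below 0 U" "U $$ 0 = 1" for k U
    using that
  proof (induction k arbitrary: U)
    case (Suc k)
    have "vanishes_below (2 * 0) U" "U $$ (2 * 0) = 1\<^sup>2" using Suc.prems by simp_all
    then obtain W where W: "vanishes_below 0 W" "W $$ 0 = 1" "W \<star> W = U"
      using square_root_exists[of 0 U 1 1] by auto
    have "W \<noteq> 0" using W(2) by auto
    then have nz: "\<Theta> W \<noteq> 0" by (simp add: \<Theta>_eq_0)
    have "fls_subdegree (\<Theta> U) = 2 * fls_subdegree (\<Theta> W)"
      using star_subdegree(2)[OF nz nz] by (simp add: \<Theta>_star flip: W(3))
    then show ?case using Suc.IH[OF W(1,2)] by simp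
  qed simp
  define z where "z = fls_subdegree (\<Theta> U)"
  have "z = 0"
  proof (rule ccontr)
    assume "z \<noteq> 0"
    then have "2 ^ nat \<bar>z\<bar> \<le> \<bar>z\<bar>"
      using dvd_imp_le_int[of z "2 ^ nat \<bar>z\<bar>"] dvd[OF assms, of "nat \<bar>z\<bar>"]
      by (simp add: z_def)
    moreover have "int (nat \<bar>z\<bar>) < 2 ^ nat \<bar>z\<bar>"
      by (rule of_nat_less_two_power)
    ultimately show False by simp
  qed
  then show ?thesis by (simp add: z_def)
qed

text \<open>
  For \<open>F\<close> of positive degree, \<open>\<Theta> F = \<Theta> (1 + F) - 1\<close> cannot have negative degree; the other cases
  follow by splitting off constant terms and powers of \<open>y\<close>, whose images have the right degree.
\<close>

lemma filtered_\<Theta>: "filtered \<Theta> 0"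
proof -
  have 1: "vanishes_below 0 (\<Theta> F)" if "vanishes_below 1 F" for F
  proof -
    have "fls_subdegree (\<Theta> (1 + F)) = 0"
      using that by (intro \<Theta>_one_unit_subdegree) (auto simp: vanishes_below_def)
    then have "vanishes_below 0 (1 + \<Theta> F)"
      using vanishes_below_subdegree[of "\<Theta> (1 + F)"] by (simp add: \<Theta>_add \<Theta>_1)
    then show ?thesis by (simp add: vanishes_below_def)
  qed
  have 0: "vanishes_below 0 (\<Theta> F)" if "vanishes_below 0 F" for F
  proof -
    have "vanishes_below 1 (F - fls_const (F $$ 0))"
      using vanishes_below_diff_lead[OF that] by (simp add: fls_monom_degree_0)
    from 1[OF this] have "vanishes_below 0 (\<Theta> F - fls_const (\<alpha> (F $$ 0)))"
      by (simp add: \<Theta>_diff \<Theta>_const)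
    then show ?thesis by (simp add: vanishes_below_def)
  qed
  show ?thesis
    unfolding filtered_def
  proof (intro allI impI)
    fix m and F :: "'a fls" assume "vanishes_below m F"
    then have "vanishes_below 0 (\<Theta> (fls_shift m F))"
      by (intro 0) (simp add: vanishes_below_shift)
    moreover have "vanishes_below m (\<Theta> (fls_monom 1 m))"
      using vanishes_below_subdegree[of "\<Theta> (fls_monom 1 m)"] by (simp add: \<Theta>_power_subdegree)
    ultimately have "vanishes_below (0 + m) (\<Theta> (fls_shift m F) \<star> \<Theta> (fls_monom 1 m))"
      by (rule star_vanishes_below)
    also have "\<Theta> (fls_shift m F) \<star> \<Theta> (fls_monom 1 m) = \<Theta> F"
      unfolding \<Theta>_star[symmetric] by (simp add: star_monom_right)
    finally show "vanishes_below (m + 0) (\<Theta> F)" by simp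
  qed
qed

text \<open>
  The image of \<open>x\<inverse>\<close> is even, hence so are those of the powers of \<open>x\<close>: from \<open>P K\<close> and \<open>K\<close>
  even it follows that \<open>P\<close> is, as \<open>C\<close> has no zero divisors.  Continuity does the rest.
\<close>

lemma \<Theta>_pdo_even:
  assumes "F \<in> pdo_even"
  shows "\<Theta> F \<in> pdo_even"
proof -
  note parity_star = pdo_homD(2)[OF parity_hom] and parity_diff = pdo_homD(3)[OF parity_hom]
  define K where "K = \<Theta> (fls_monom 1 (- 2))"
  have "K \<noteq> 0" by (simp add: K_def \<Theta>_eq_0)
  obtain a b where "K = fls_monom a (- 2) + fls_const b"
    unfolding K_def by (rule \<Theta>_x_inverse)
  then have K: "parity K = K"
    by (simp add: fls_eq_iff parity_nth)
  have powers: "parity (\<Theta> (fls_monom 1 (2 * j))) = \<Theta> (fls_monom 1 (2 * j))" for j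
  proof (induction j rule: int_funpow_induct)
    case zero
    show ?case using \<Theta>_1 by (simp add: fls_monom_degree_0 parity_1)
  next
    case (up j)
    have step: "\<Theta> (fls_monom 1 (2 * (j + 1))) \<star> K = \<Theta> (fls_monom 1 (2 * j))"
      using \<Theta>_monom_diff[of "2 * (j + 1)" 2] by (simp add: K_def)
    have "parity (\<Theta> (fls_monom 1 (2 * (j + 1)))) \<star> K = \<Theta> (fls_monom 1 (2 * (j + 1))) \<star> K"
      using parity_star[of "\<Theta> (fls_monom 1 (2 * (j + 1)))" K] unfolding step up K by simp
    then show ?case by (rule star_right_cancel) fact
  next
    case (down j)
    have "\<Theta> (fls_monom 1 (2 * (j - 1))) = \<Theta> (fls_monom 1 (2 * j)) \<star> K"
      using \<Theta>_monom_diff[of "2 * j" 2] by (simp add: K_def algebra_simps)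
    then show ?case by (simp add: parity_star down K)
  qed
  \<comment> \<open>\<open>F + parity F\<close> is twice the even part of \<open>F\<close>, so \<open>N\<close> vanishes on monomials of odd degree too.\<close>
  define N where "N F = parity (\<Theta> (F + parity F)) - \<Theta> (F + parity F)" for F
  have "N F = 0"
  proof (rule additive_filtered_eq_0[of N 0])
    show "N (F + G) = N F + N G" for F G
      by (simp add: N_def parity_add \<Theta>_add)
    show "filtered N 0"
      unfolding filtered_def
    proof (intro allI impI)
      fix m and F :: "'a fls" assume "vanishes_below m F"
      then have "vanishes_below m (F + parity F)"
        using filteredD[OF filtered_parity] by (fastforce intro: vanishes_below_add)
      then have "vanishes_below m (\<Theta> (F + parity F))"
        using filteredD[OF filtered_\<Theta>] by fastforce
      then show "vanishes_below (m + 0) (N F)"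
        using filteredD[OF filtered_parity] unfolding N_def by (fastforce intro: vanishes_below_diff)
    qed
    show "N (fls_monom f i) = 0" for f i
    proof (cases "even i")
      case True
      then obtain j where i: "i = 2 * j" by (rule evenE)
      have "parity (\<Theta> (fls_monom f i)) = \<Theta> (fls_monom f i)"
        unfolding i monom_eq_star[of f "2 * j"] \<Theta>_star parity_star \<Theta>_const parity_const powers
        by (rule refl)
      moreover have "parity (fls_monom f i) = fls_monom f i"
        using True by (simp add: parity_monom)
      ultimately show ?thesis
        by (simp only: N_def \<Theta>_add parity_add diff_self)
    next
      case False
      then have "fls_monom f i + parity (fls_monom f i) = 0"
        by (simp add: parity_monom fls_eq_iff)
      then show ?thesis using additive_0[of parity, OF parity_add] by (simp add: N_def \<Theta>_0)
    qed
  qed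
  moreover have "N F = 2 * (parity (\<Theta> F) - \<Theta> F)"
    using assms unfolding pdo_even_iff_parity
    by (simp only: N_def parity_add \<Theta>_add) (simp add: algebra_simps)
  ultimately have "parity (\<Theta> F) = \<Theta> F" by simp
  then show ?thesis by (simp add: pdo_even_iff_parity)
qed

end

section \<open>Extending group actions\<close>

lemma ring_iso_type_ringD:
  assumes "h \<in> ring_iso type_ring type_ring"
  shows "h (f + g) = h f + h g" "h (f * g) = h f * h g" "h 1 = 1" "bij h"
  using assms by (auto simp: ring_iso_def ring_hom_def type_ring_def)

lemma ring_iso_pdo_ring_iff:
  "\<Theta> \<in> ring_iso (pdo_ring \<iota> \<delta>) (pdo_ring \<iota> \<delta>) \<longleftrightarrow> bij \<Theta> \<and> \<Theta> 1 = 1 \<and>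
    (\<forall>F G. \<Theta> (F + G) = \<Theta> F + \<Theta> G) \<and>
    (\<forall>F G. \<Theta> (pdo_mult \<iota> \<delta> F G) = pdo_mult \<iota> \<delta> (\<Theta> F) (\<Theta> G))"
  by (auto simp: ring_iso_def ring_hom_def pdo_ring_def)

lemma Units_type_ring_iff: "u \<in> Units type_ring \<longleftrightarrow> (\<exists>v. u * v = (1 :: 'a::comm_ring_1))"
  by (auto simp: Units_def type_ring_def mult.commute)

context quadratic_pdo
begin

lemma extends_to_pdoD:
  assumes ext: "extends_to_pdo \<iota> \<delta> \<Gamma> act Act"
    and act: "right_action_by_automorphisms \<Gamma> type_ring act"
    and d_nonzero: "\<exists>f. d f \<noteq> 0" and \<gamma>: "\<gamma> \<in> carrier \<Gamma>"
  shows "pdo_extension \<iota> d (act \<gamma>) (Act \<gamma>)"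
proof
  have "act \<gamma> \<in> ring_iso type_ring type_ring"
    using act \<gamma> by (simp add: right_action_by_automorphisms_def)
  note ring_iso_type_ringD[OF this]
  then show "surj (act \<gamma>)" "act \<gamma> 1 = 1"
    by (simp_all add: bij_is_surj)
  have "Act \<gamma> \<in> ring_iso (pdo_ring \<iota> \<delta>) (pdo_ring \<iota> \<delta>)"
    using ext \<gamma> by (simp add: extends_to_pdo_def right_action_by_automorphisms_def)
  then show "pdo_hom (Act \<gamma>)" "inj (Act \<gamma>)"
    by (simp_all add: ring_iso_pdo_ring_iff pdo_hom_def bij_is_inj)
  show "Act \<gamma> (fls_const f) = fls_const (act \<gamma> f)" for f
    using ext \<gamma> by (simp add: extends_to_pdo_def)
qed (fact d_nonzero)

lemma quadratically_compatible_if_extends: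
  assumes ext: "extends_to_pdo \<iota> \<delta> \<Gamma> act Act"
    and act: "right_action_by_automorphisms \<Gamma> type_ring act"
    and d_nonzero: "\<exists>f. d f \<noteq> 0"
  shows "quadratically_compatible \<Gamma> d act"
proof -
  let ?y' = "fls_monom 1 (- 1) :: 'a fls"
  define s where "s \<gamma> = Act \<gamma> ?y' $$ (- 1)" for \<gamma>
  note ext_\<gamma> = extends_to_pdoD[OF ext act d_nonzero]
  have s_eq: "s \<gamma> = pdo_extension.multiplier (Act \<gamma>)" if "\<gamma> \<in> carrier \<Gamma>" for \<gamma>
    by (simp add: s_def pdo_extension.multiplier_def[OF ext_\<gamma>[OF that]])
  have cocycle: "s (\<gamma> \<otimes>\<^bsub>\<Gamma>\<^esub> \<gamma>') = act \<gamma>' (s \<gamma>) * s \<gamma>'"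
    if \<gamma>: "\<gamma> \<in> carrier \<Gamma>" and \<gamma>': "\<gamma>' \<in> carrier \<Gamma>" for \<gamma> \<gamma>'
  proof -
    interpret A: pdo_extension \<iota> d "act \<gamma>" "Act \<gamma>" by (rule ext_\<gamma>[OF \<gamma>])
    interpret A': pdo_extension \<iota> d "act \<gamma>'" "Act \<gamma>'" by (rule ext_\<gamma>[OF \<gamma>'])
    have "vanishes_below (- 1) (Act \<gamma> ?y')"
      using vanishes_below_subdegree[of "Act \<gamma> ?y'"] by (simp add: A.\<Theta>_power_subdegree)
    from leading_coeff_compose[OF A'.hom A'.filtered_\<Theta> A'.\<Theta>_const this]
    have "Act \<gamma>' (Act \<gamma> ?y') $$ (- 1) = act \<gamma>' (s \<gamma>) * s \<gamma>'"
      by (simp add: s_def)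
    moreover have "Act \<gamma>' (Act \<gamma> ?y') = Act (\<gamma> \<otimes>\<^bsub>\<Gamma>\<^esub> \<gamma>') ?y'"
      using ext \<gamma> \<gamma>'
      by (simp add: extends_to_pdo_def right_action_by_automorphisms_def pdo_ring_def)
    ultimately show ?thesis by (simp add: s_def)
  qed
  have "s \<gamma> \<in> Units type_ring" if "\<gamma> \<in> carrier \<Gamma>" for \<gamma>
    unfolding s_eq[OF that] Units_type_ring_iff by (rule pdo_extension.multiplier_unit[OF ext_\<gamma>[OF that]])
  with cocycle have "s \<in> unit_cocycles \<Gamma> act"
    by (auto simp: unit_cocycles_def)
  moreover have "act \<gamma> (d f) = (s \<gamma>)\<^sup>2 * d (act \<gamma> f)" if "\<gamma> \<in> carrier \<Gamma>" for \<gamma> f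
    unfolding s_eq[OF that] by (rule pdo_extension.\<alpha>_d[OF ext_\<gamma>[OF that]])
  ultimately show ?thesis by (auto simp: quadratically_compatible_def)
qed

text \<open>
  The extensions that belong to the values of the cocycle compose as the group elements do, because
  both sides belong to the same value; inverse group elements then provide bijectivity.
\<close>

lemma extends_if_quadratically_compatible:
  assumes grp: "group \<Gamma>"
    and act: "right_action_by_automorphisms \<Gamma> type_ring act"
    and compat: "quadratically_compatible \<Gamma> d act"
  shows "\<exists>Act. extends_to_pdo \<iota> \<delta> \<Gamma> act Act"
proof -
  interpret \<Gamma>: group \<Gamma> by (rule grp)
  obtain s where s: "s \<in> unit_cocycles \<Gamma> act"
    and s_d: "\<And>\<gamma> f. \<gamma> \<in> carrier \<Gamma> \<Longrightarrow> act \<gamma> (d f) = (s \<gamma>)\<^sup>2 * d (act \<gamma> f)"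
    using compat by (auto simp: quadratically_compatible_def)
  have s_unit: "\<exists>s'. s \<gamma> * s' = 1" if "\<gamma> \<in> carrier \<Gamma>" for \<gamma>
    using s that by (auto simp: unit_cocycles_def simp flip: Units_type_ring_iff)
  then have s_nz: "s \<gamma> \<noteq> 0" if "\<gamma> \<in> carrier \<Gamma>" for \<gamma>
    using that by fastforce
  have s_mult: "s (\<gamma> \<otimes>\<^bsub>\<Gamma>\<^esub> \<gamma>') = act \<gamma>' (s \<gamma>) * s \<gamma>'"
    if "\<gamma> \<in> carrier \<Gamma>" "\<gamma>' \<in> carrier \<Gamma>" for \<gamma> \<gamma>'
    using s that by (simp add: unit_cocycles_def)
  have iso: "act \<gamma> \<in> ring_iso type_ring type_ring" if "\<gamma> \<in> carrier \<Gamma>" for \<gamma>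
    using act that by (simp add: right_action_by_automorphisms_def)
  have act_1: "act \<one>\<^bsub>\<Gamma>\<^esub> = (\<lambda>f. f)"
    using act by (auto simp: right_action_by_automorphisms_def type_ring_def)
  have act_mult: "(\<lambda>f. act \<gamma>' (act \<gamma> f)) = act (\<gamma> \<otimes>\<^bsub>\<Gamma>\<^esub> \<gamma>')"
    if "\<gamma> \<in> carrier \<Gamma>" "\<gamma>' \<in> carrier \<Gamma>" for \<gamma> \<gamma>'
    using act that by (auto simp: right_action_by_automorphisms_def type_ring_def)
  have s_1: "s \<one>\<^bsub>\<Gamma>\<^esub> = 1"
    using s_mult[of "\<one>\<^bsub>\<Gamma>\<^esub>" "\<one>\<^bsub>\<Gamma>\<^esub>"] s_nz[of "\<one>\<^bsub>\<Gamma>\<^esub>"] by (simp add: act_1)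
  have "\<forall>\<gamma> \<in> carrier \<Gamma>. \<exists>\<Theta>. extension_with (act \<gamma>) (s \<gamma>) \<Theta>"
  proof
    fix \<gamma> assume \<gamma>: "\<gamma> \<in> carrier \<Gamma>"
    obtain s' where "s \<gamma> * s' = 1" using s_unit[OF \<gamma>] by blast
    with ring_iso_type_ringD[OF iso[OF \<gamma>]] s_d[OF \<gamma>]
    show "\<exists>\<Theta>. extension_with (act \<gamma>) (s \<gamma>) \<Theta>"
      by (intro extension_with_exists) auto
  qed
  then obtain Act where Act: "\<And>\<gamma>. \<gamma> \<in> carrier \<Gamma> \<Longrightarrow> extension_with (act \<gamma>) (s \<gamma>) (Act \<gamma>)"
    using bchoice by metis
  note hom = pdo_homD[OF extension_withD(1)[OF Act]]
  have Act_1: "Act \<one>\<^bsub>\<Gamma>\<^esub> F = F" for F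
    using extension_with_unique[OF Act[of "\<one>\<^bsub>\<Gamma>\<^esub>"], of "\<lambda>F. F" F] extension_with_id
    by (simp add: act_1 s_1)
  have Act_mult: "Act \<gamma>' (Act \<gamma> F) = Act (\<gamma> \<otimes>\<^bsub>\<Gamma>\<^esub> \<gamma>') F"
    if \<gamma>: "\<gamma> \<in> carrier \<Gamma>" and \<gamma>': "\<gamma>' \<in> carrier \<Gamma>" for \<gamma> \<gamma>' F
  proof (rule extension_with_unique[where \<Theta> = "\<lambda>F. Act \<gamma>' (Act \<gamma> F)"])
    show "extension_with (act (\<gamma> \<otimes>\<^bsub>\<Gamma>\<^esub> \<gamma>')) (s (\<gamma> \<otimes>\<^bsub>\<Gamma>\<^esub> \<gamma>')) (\<lambda>F. Act \<gamma>' (Act \<gamma> F))"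
      using extension_with_compose[OF Act[OF \<gamma>] Act[OF \<gamma>']]
      by (simp only: s_mult[OF \<gamma> \<gamma>'] act_mult[OF \<gamma> \<gamma>'])
  qed (use \<gamma> \<gamma>' in \<open>simp_all add: Act s_nz\<close>)
  have "Act \<gamma> \<in> ring_iso (pdo_ring \<iota> \<delta>) (pdo_ring \<iota> \<delta>)" if \<gamma>: "\<gamma> \<in> carrier \<Gamma>" for \<gamma>
  proof -
    have "bij (Act \<gamma>)"
      by (rule o_bij[of "Act (inv\<^bsub>\<Gamma>\<^esub> \<gamma>)"])
        (simp_all add: fun_eq_iff Act_mult \<gamma> Act_1)
    moreover have "Act \<gamma> 1 = 1"
      using extension_withD(3)[OF Act[OF \<gamma>], of 1] ring_iso_type_ringD(3)[OF iso[OF \<gamma>]] by simp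
    ultimately show ?thesis
      by (simp add: ring_iso_pdo_ring_iff hom(1,2)[OF \<gamma>])
  qed
  then have "extends_to_pdo \<iota> \<delta> \<Gamma> act Act"
    using Act_1 Act_mult extension_withD(3)[OF Act]
    by (simp add: extends_to_pdo_def right_action_by_automorphisms_def)
  then show ?thesis by blast
qed

end

theorem theorem1p2p9:
  fixes \<iota> :: "rat \<Rightarrow> 'a::{idom, ring_char_0}"
    and d :: "'a \<Rightarrow> 'a"
    and \<Gamma> :: "('g, 'm) monoid_scheme"
    and act :: "'g \<Rightarrow> 'a \<Rightarrow> 'a"
  assumes "rational_embedding \<iota>"
    and "derivation d"
    and "d \<noteq> (\<lambda>f. 0)"
    and "group \<Gamma>"
    and "right_action_by_automorphisms \<Gamma> type_ring act"
  shows "((\<exists>Act. extends_to_pdo \<iota> (\<lambda>f. \<iota> (1 / 2) * d f) \<Gamma> act Act) \<longleftrightarrow>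
      quadratically_compatible \<Gamma> d act) \<and>
    (\<forall>Act. extends_to_pdo \<iota> (\<lambda>f. \<iota> (1 / 2) * d f) \<Gamma> act Act \<longrightarrow>
      (\<forall>\<gamma> \<in> carrier \<Gamma>. Act \<gamma> ` pdo_even \<subseteq> pdo_even))"
proof -
  interpret quadratic_pdo \<iota> d
    by unfold_locales (fact assms)+
  have \<delta>_eq: "(\<lambda>f. \<iota> (1 / 2) * d f) = \<delta>"
    by (simp add: fun_eq_iff \<delta>_def)
  have d_nonzero: "\<exists>f. d f \<noteq> 0"
    using assms(3) by (simp add: fun_eq_iff)
  show ?thesis
    unfolding \<delta>_eq
  proof (intro conjI iffI allI impI ballI)
    assume "\<exists>Act. extends_to_pdo \<iota> \<delta> \<Gamma> act Act"
    then show "quadratically_compatible \<Gamma> d act"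
      using quadratically_compatible_if_extends[OF _ assms(5) d_nonzero] by blast
  next
    assume "quadratically_compatible \<Gamma> d act"
    then show "\<exists>Act. extends_to_pdo \<iota> \<delta> \<Gamma> act Act"
      by (rule extends_if_quadratically_compatible[OF assms(4,5)])
  next
    fix Act \<gamma> assume "extends_to_pdo \<iota> \<delta> \<Gamma> act Act" "\<gamma> \<in> carrier \<Gamma>"
    from extends_to_pdoD[OF this(1) assms(5) d_nonzero this(2)]
    show "Act \<gamma> ` pdo_even \<subseteq> pdo_even"
      using pdo_extension.\<Theta>_pdo_even by blast
  qed
qed

end
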